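(* Let $\Gamma_k(x,\varepsilon)$ be defined by $\Gamma_0(x,\varepsilon)=\gamma(x)$ and $$g(x,\Gamma_{k+1}(x,\varepsilon))=\varepsilon\,\nabla_x\Gamma_k(x,\varepsilon)\,f(x,\Gamma_k(x,\varepsilon)),\qquad k=0,1,2,\dots.$$ Let $(x(t),y(t))$ solve $$\frac{dx}{dt}=f(x,y),\qquad\frac{dy}{dt}=\frac1\varepsilon g(x,y),\qquad x(0)=x_0,\ y(0)=y_0,$$ let $z_k(t)=y(t)-\Gamma_k(x(t),\varepsilon)$, and let $X_k(t)$ solve $\frac{dX_k}{dt}=f(X_k,\Gamma_k(X_k,\varepsilon))$. Then for any $k=0,1,\dots,K$ there exists a constant $C_k>0$, dependent on $k$ and independent of $\varepsilon$, such that (for all $t\ge0$) $$|x(t)-X_k(t)|^2\le e^{C_kt}\left(|x(0)-X_k(0)|^2+\varepsilon^{2k+2}+\frac{C_k\varepsilon}{\beta}|z_k(0)|^2\right).$$ In particular, if $|x(0)-X_k(0)|=\mathcal O(\varepsilon^{k+1})$ and $|z_k(0)|=\mathcal O(\varepsilon^{k+\frac12})$, then $|x(t)-X_k(t)|=\mathcal O(\varepsilon^{k+1})$ for $t\sim\mathcal O(1)$ (i.e. for $t$ in any bounded time interval fixed independently of $\varepsilon$).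
   Context: Setting: $n_x,n_y\ge1$ are integers, $0<\varepsilon\le\varepsilon_0\ll1$, and $f:\mathbb R^{n_x}\times\mathbb R^{n_y}\to\mathbb R^{n_x}$, $g:\mathbb R^{n_x}\times\mathbb R^{n_y}\to\mathbb R^{n_y}$ are sufficiently smooth functions such that, for some fixed integer $K\ge1$, $f\in W^{K,\infty}$ and $\nabla g\in W^{K,\infty}$, where $\|\xi\|_{k,\infty}=\max_{0\le j\le k}\|\nabla^j\xi\|_{L^\infty}$ is the $W^{k,\infty}$ norm. For each $x\in\mathbb R^{n_x}$ there is $\gamma(x)\in\mathbb R^{n_y}$ with $g(x,\gamma(x))=0$, and there is $\beta>0$ with $\langle g(x,y)-g(x,\tilde y),y-\tilde y\rangle\le-\beta|y-\tilde y|^2$ for all $x\in\mathbb R^{n_x}$, $y,\tilde y\in\mathbb R^{n_y}$. Hence for each $x$ the map $g(x,\cdot)$ is a bijection of $\mathbb R^{n_y}$, so $\gamma$ is unique and the iteration defining $\Gamma_{k+1}$ has a unique solution. $\nabla_x\Gamma_k$ denotes the $n_y\times n_x$ Jacobian matrix in $x$. *)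

theory Defs
  imports
    "HOL-Analysis.Analysis"
    "HOL-Library.Landau_Symbols"
    "HOL-Probability.Essential_Supremum"
begin

text \<open>
  The tensor \<open>\<nabla>\<^sup>j \<xi>(z)\<close> is represented by its components
  \<open>partial_deriv vs \<xi> z\<close>, where \<open>vs\<close> runs over the lists of \<open>j\<close> basis vectors.
  The value is only meaningful where the Frechet derivatives involved exist.
\<close>

primrec partial_deriv ::
    "'a::euclidean_space list \<Rightarrow> ('a \<Rightarrow> 'b::real_normed_vector) \<Rightarrow> 'a \<Rightarrow> 'b" where
  "partial_deriv [] \<xi> = \<xi>"
| "partial_deriv (v # vs) \<xi> = (\<lambda>z. frechet_derivative (partial_deriv vs \<xi>) (at z) v)"

definition multi_indices :: "nat \<Rightarrow> 'a::euclidean_space list set" where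
  "multi_indices j = {vs. set vs \<subseteq> Basis \<and> length vs = j}"

definition C_k_smooth :: "nat \<Rightarrow> ('a::euclidean_space \<Rightarrow> 'b::real_normed_vector) \<Rightarrow> bool" where
  "C_k_smooth k \<xi> \<longleftrightarrow>
     (\<forall>j<k. \<forall>vs\<in>multi_indices j. \<forall>z. partial_deriv vs \<xi> differentiable (at z)) \<and>
     (\<forall>j\<le>k. \<forall>vs\<in>multi_indices j. continuous_on UNIV (partial_deriv vs \<xi>))"

text \<open>
  \<open>nabla_norm j \<xi> z\<close> is the Euclidean (Frobenius) norm of the tensor \<open>\<nabla>\<^sup>j \<xi>(z)\<close>, and
  \<open>sobolev_norm k \<xi>\<close> is the \<open>W\<^bsup>k,\<infinity>\<^esup>\<close> norm.  Classical derivatives are used, so the latter is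
  only meaningful for \<open>\<xi>\<close> of class \<open>C\<^sup>k\<close>.
\<close>

definition nabla_norm ::
    "nat \<Rightarrow> ('a::euclidean_space \<Rightarrow> 'b::real_normed_vector) \<Rightarrow> 'a \<Rightarrow> real" where
  "nabla_norm j \<xi> z = L2_set (\<lambda>vs. norm (partial_deriv vs \<xi> z)) (multi_indices j)"

definition sobolev_norm ::
    "nat \<Rightarrow> ('a::euclidean_space \<Rightarrow> 'b::real_normed_vector) \<Rightarrow> ereal" where
  "sobolev_norm k \<xi> = (MAX j\<in>{0..k}. esssup lebesgue (\<lambda>z. ereal (nabla_norm j \<xi> z)))"

definition gradient ::
    "('a::euclidean_space \<Rightarrow> 'b::real_normed_vector) \<Rightarrow> 'a \<Rightarrow> 'a \<Rightarrow>\<^sub>L 'b" where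
  "gradient g z = Blinfun (frechet_derivative g (at z))"

text \<open>Solutions are global forward in time; the derivative at \<open>t = 0\<close> is one-sided.\<close>

definition slow_fast_solution ::
    "('a::real_normed_vector \<times> 'b::real_normed_vector \<Rightarrow> 'a) \<Rightarrow> ('a \<times> 'b \<Rightarrow> 'b) \<Rightarrow> real \<Rightarrow>
     'a \<Rightarrow> 'b \<Rightarrow> (real \<Rightarrow> 'a) \<Rightarrow> (real \<Rightarrow> 'b) \<Rightarrow> bool" where
  "slow_fast_solution f g \<epsilon> x0 y0 x y \<longleftrightarrow>
     x 0 = x0 \<and> y 0 = y0 \<and>
     (\<forall>t\<ge>0. (x has_vector_derivative f (x t, y t)) (at t within {0..}) \<and>
            (y has_vector_derivative (1 / \<epsilon>) *\<^sub>R g (x t, y t)) (at t within {0..}))"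

definition reduced_solution ::
    "('a::real_normed_vector \<times> 'b::real_normed_vector \<Rightarrow> 'a) \<Rightarrow> ('a \<Rightarrow> 'b) \<Rightarrow> (real \<Rightarrow> 'a) \<Rightarrow> bool" where
  "reduced_solution f G X \<longleftrightarrow>
     (\<forall>t\<ge>0. (X has_vector_derivative f (X t, G (X t))) (at t within {0..}))"

end

theory Submission imports Defs begin

text \<open>
  Uniform regularity of \<open>\<Gamma>\<^sub>k\<close> comes from the implicit equation: dissipativity makes
  \<open>\<partial>\<^sub>y g\<close> invertible with inverse bounded by \<open>1/\<beta>\<close>, so \<open>\<Gamma>\<^sub>k\<close> has bounded
  derivatives of the orders \<open>1, \<dots>, K + 1 - k\<close>, uniformly in \<open>\<epsilon>\<close>.  Subtracting two consecutive
  equations shows that \<open>\<Gamma>\<^sub>k\<^sub>+\<^sub>1 - \<Gamma>\<^sub>k\<close> is \<open>O(\<epsilon>\<^bsup>k+1\<^esup>)\<close> together with its derivatives up to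
  order \<open>K - k\<close>.  Hence the invariance defect \<open>\<epsilon> \<nabla>\<Gamma>\<^sub>k f(x, \<Gamma>\<^sub>k) - g(x, \<Gamma>\<^sub>k)\<close> is \<open>O(\<epsilon>\<^bsup>k+1\<^esup>)\<close>.
  With \<open>z = y - \<Gamma>\<^sub>k(x)\<close>, the functional
  \<open>V = |x - X|\<^sup>2 + (\<epsilon>/\<beta>) |z|\<^sup>2 + \<epsilon>\<^bsup>2k+2\<^esup>\<close> then satisfies \<open>V' \<le> C V\<close>: the dissipation of
  \<open>(\<epsilon>/\<beta>) |z|\<^sup>2\<close> absorbs the coupling term \<open>|z|\<^sup>2\<close>.
\<close>

section \<open>Dissipative implicit equations\<close>

text \<open>The bookkeeping is shaped by two losses of regularity. Forming
  \<open>\<nabla>\<Gamma>_k f\<close> costs one derivative of \<open>\<Gamma> k\<close>, so the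
  available order falls by one per iteration; this is the budget \<open>k + n = K\<close> in
  \<open>slow_manifold_bounds\<close>. Comparing two solutions of the implicit equation to order
  \<open>n\<close> asks for order \<open>n + 1\<close> of \<open>g\<close>, because derivatives of
  \<open>g\<close> at two different points are subtracted. Sup bounds alone cannot be iterated: the
  next defect contains the derivative of the difference of consecutive manifolds, so smallness has
  to be propagated in all available orders at once. Differentiability of \<open>\<Gamma> k\<close>
  is not a hypothesis, and the recursion says something useful only where it holds. Each iteration
  therefore proves regularity before the next equation is used; monotonicity in \<open>y\<close>
  supplies the stability that makes this possible globally. The weight \<epsilon>/\<beta> is the
  reciprocal of the relaxation rate \<beta>/\<epsilon> of \<open>z\<close>. It turns the dissipation
  into 2|z|^2, free of \<epsilon>: one copy pays for the coupling, the other for the defect.\<close>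

lemma dissipative_derivative:
  fixes g :: "'a::real_normed_vector \<times> 'b::real_inner \<Rightarrow> 'b"
  assumes diss: "\<And>x y y'. (g (x, y) - g (x, y')) \<bullet> (y - y') \<le> - \<beta> * (norm (y - y'))\<^sup>2"
    and g': "(g has_derivative g') (at (x, y))"
  shows "g' (0, w) \<bullet> w \<le> - \<beta> * (norm w)\<^sup>2"
proof -
  have "((\<lambda>s. g (x, y + s *\<^sub>R w)) has_derivative (\<lambda>s. g' (0, s *\<^sub>R w))) (at (0::real))"
  proof (rule has_derivative_compose[of "\<lambda>s. (x, y + s *\<^sub>R w)" _ _ _ g g'])
    show "((\<lambda>s. (x, y + s *\<^sub>R w)) has_derivative (\<lambda>s. (0, s *\<^sub>R w))) (at (0::real))"
      by (intro has_derivative_Pair) (auto intro!: derivative_eq_intros)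
  qed (use g' in simp)
  then have "((\<lambda>s. g (x, y + s *\<^sub>R w) \<bullet> w) has_derivative (\<lambda>s. g' (0, s *\<^sub>R w) \<bullet> w)) (at (0::real))"
    by (auto intro!: derivative_eq_intros)
  moreover have "g' (0, s *\<^sub>R w) \<bullet> w = (g' (0, w) \<bullet> w) * s" for s
    using linear_scale[OF has_derivative_linear[OF g'], of s "(0, w)"] by simp
  ultimately have "((\<lambda>s. g (x, y + s *\<^sub>R w) \<bullet> w) has_real_derivative g' (0, w) \<bullet> w) (at 0)"
    by (simp only: has_field_derivative_def)
  \<comment> \<open>The limit is taken from the right only, since dividing the monotonicity
    inequality by \<open>s\<close> keeps its direction for \<open>s > 0\<close>.\<close>
  then have "((\<lambda>s. (g (x, y + s *\<^sub>R w) \<bullet> w - g (x, y) \<bullet> w) / s) \<longlongrightarrow> g' (0, w) \<bullet> w) (at_right 0)"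
    by (auto simp: has_field_derivative_iff intro: filterlim_mono at_le)
  moreover have "\<forall>\<^sub>F s in at_right 0. (g (x, y + s *\<^sub>R w) \<bullet> w - g (x, y) \<bullet> w) / s \<le> - \<beta> * (norm w)\<^sup>2"
  proof (rule eventually_at_rightI[of 0 1])
    fix s :: real assume s: "s \<in> {0<..<1}"
    have "s * ((g (x, y + s *\<^sub>R w) - g (x, y)) \<bullet> w) \<le> s * (- \<beta> * (norm w)\<^sup>2 * s)"
      using diss[of x "y + s *\<^sub>R w" y] s by (simp add: power_mult_distrib power2_eq_square algebra_simps)
    then have "(g (x, y + s *\<^sub>R w) - g (x, y)) \<bullet> w \<le> - \<beta> * (norm w)\<^sup>2 * s"
      by (rule mult_left_le_imp_le) (use s in simp)
    then show "(g (x, y + s *\<^sub>R w) \<bullet> w - g (x, y) \<bullet> w) / s \<le> - \<beta> * (norm w)\<^sup>2"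
      using s by (simp add: inner_diff_left pos_divide_le_eq)
  qed simp
  ultimately show ?thesis
    by (rule tendsto_upperbound) simp
qed

text \<open>Cauchy-Schwarz. It serves twice: with \<open>a\<close> a difference of values of
  \<open>g\<close> it is stability of the implicit equation, and with \<open>a\<close> the image of
  \<open>w\<close> under the partial derivative in \<open>y\<close> it bounds the inverse of that
  derivative by 1/\<beta>.\<close>

lemma norm_le_of_dissipative:
  fixes a w :: "'b::real_inner"
  assumes "\<beta> > 0" and "a \<bullet> w \<le> - \<beta> * (norm w)\<^sup>2"
  shows "\<beta> * norm w \<le> norm a"
proof (cases "w = 0")
  case False
  have "\<beta> * norm w * norm w \<le> norm a * norm w"
    using assms Cauchy_Schwarz_ineq2[of a w] by (simp add: power2_eq_square)
  then show ?thesis using False by simp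
qed simp

text \<open>Strong monotonicity replaces the local uniqueness argument of the implicit function
  theorem: it controls the increment of \<open>u\<close> at \<open>x0\<close> directly, so that
  differentiability of \<open>g\<close> at a single point is enough and no continuity of
  \<open>u\<close> is presupposed.\<close>

lemma implicit_differentiable:
  fixes g :: "'a::euclidean_space \<times> 'b::euclidean_space \<Rightarrow> 'b"
  assumes beta: "\<beta> > 0"
    and diss: "\<And>x y y'. (g (x, y) - g (x, y')) \<bullet> (y - y') \<le> - \<beta> * (norm (y - y'))\<^sup>2"
    and g: "g differentiable (at (x0, u x0))"
    and q: "q differentiable (at x0)"
    and eq: "\<And>x. g (x, u x) = q x"
  shows "u differentiable (at x0)"
proof -
  obtain g' where g': "(g has_derivative g') (at (x0, u x0))"
    using g by (auto simp: differentiable_def)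
  obtain q' where q': "(q has_derivative q') (at x0)"
    using q by (auto simp: differentiable_def)
  interpret g': bounded_linear g' using g' by (rule has_derivative_bounded_linear)
  interpret q': bounded_linear q' using q' by (rule has_derivative_bounded_linear)
  have lin: "linear (\<lambda>w. g' (0, w))"
    by (rule linearI) (simp_all flip: g'.add g'.scaleR)
  have "inj (\<lambda>w. g' (0, w))"
    unfolding linear_injective_0[OF lin]
    using norm_le_of_dissipative[OF beta dissipative_derivative[OF diss g']] beta
    by (metis mult_le_0_iff norm_le_zero_iff norm_zero not_less)
  \<comment> \<open>The bound \<beta>|w| <= |g'(0,w)| makes the kernel trivial; a left inverse of
    the partial derivative in \<open>y\<close> suffices for solving the linearised equation for the
    increment of \<open>u\<close>.\<close>
  then obtain B where B: "linear B" and BA: "B \<circ> (\<lambda>w. g' (0, w)) = id"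
    using linear_injective_left_inverse[OF lin] by blast
  have BA: "B (g' (0, w)) = w" for w using BA by (metis comp_apply id_apply)
  interpret B: bounded_linear B using B by (simp add: linear_conv_bounded_linear)
  \<comment> \<open>The candidate comes from linearising \<open>g (x, u x) = q x\<close>, that is
    g'(h,0) + g'(0,u'h) = q'h.\<close>
  define u' where "u' h = B (q' h - g' (h, 0))" for h
  have "bounded_linear (\<lambda>h. g' (h, 0))"
    using bounded_linear_compose[OF g'.bounded_linear, of "\<lambda>h. (h, 0)"]
    by (simp add: bounded_linear_Pair bounded_linear_ident)
  then have u': "bounded_linear u'"
    unfolding u'_def
    by (intro bounded_linear_compose[OF B.bounded_linear] bounded_linear_sub q'.bounded_linear)
  obtain Kb where Kb: "Kb > 0" "\<And>w. norm (B w) \<le> norm w * Kb"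
    using B.pos_bounded by blast
  \<comment> \<open>Freezing \<open>y\<close> at \<open>u x0\<close> leaves the residual
    \<open>q x - g (x, u x0)\<close>, which vanishes at \<open>x0\<close> and equals
    \<open>g (x, u x) - g (x, u x0)\<close>. Its linear growth, with tolerance 1, yields the slope
    \<open>L = (Kp + 1) / \<beta>\<close> for \<open>u\<close> at \<open>x0\<close>.\<close>
  have "((\<lambda>x. g (x, u x0)) has_derivative (\<lambda>h. g' (h, 0))) (at x0)"
  proof (rule has_derivative_compose[of "\<lambda>x. (x, u x0)" _ _ _ g g'])
    show "((\<lambda>x. (x, u x0)) has_derivative (\<lambda>h. (h, 0))) (at x0)"
      by (intro has_derivative_Pair) (auto intro!: derivative_eq_intros)
  qed (use g' in simp)
  then have p: "((\<lambda>x. q x - g (x, u x0)) has_derivative (\<lambda>h. q' h - g' (h, 0))) (at x0)"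
    by (intro has_derivative_diff q')
  obtain Kp where Kp: "Kp > 0" "\<And>h. norm (q' h - g' (h, 0)) \<le> norm h * Kp"
    using bounded_linear.pos_bounded[OF has_derivative_bounded_linear[OF p]] by blast
  obtain d0 where d0: "d0 > 0" "\<And>x. norm (x - x0) < d0 \<Longrightarrow>
      norm (q x - g (x, u x0) - (q' (x - x0) - g' (x - x0, 0))) \<le> norm (x - x0)"
    using p[unfolded has_derivative_at_alt, THEN conjunct2, rule_format, of 1] eq by auto
  define L where "L = (Kp + 1) / \<beta>"
  have L: "L > 0" using Kp beta by (simp add: L_def)
  have u_lip: "norm (u x - u x0) \<le> L * norm (x - x0)" if "norm (x - x0) < d0" for x
  proof -
    have "\<beta> * norm (u x - u x0) \<le> norm (q x - g (x, u x0))"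
      using norm_le_of_dissipative[OF beta diss[of x "u x" "u x0"]] eq by simp
    also have "\<dots> \<le> norm (x - x0) + norm (x - x0) * Kp"
      using d0(2)[OF that] Kp(2)[of "x - x0"] norm_triangle_sub
        [of "q x - g (x, u x0)" "q' (x - x0) - g' (x - x0, 0)"] by linarith
    finally show ?thesis using beta by (simp add: L_def field_simps)
  qed
  have "(u has_derivative u') (at x0)"
    unfolding has_derivative_at_alt
  proof (intro conjI u' allI impI)
    fix e :: real assume e: "e > 0"
    \<comment> \<open>The remainder of \<open>q\<close> contributes e1|h|, that of \<open>g\<close>
      contributes e1(1 + L)|h|, and \<open>B\<close> multiplies their sum by at most
      \<open>Kb\<close>.\<close>
    define e1 where "e1 = e / (Kb * (2 + L))"
    have e1: "e1 > 0" using e Kb L by (simp add: e1_def)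
    obtain d1 where d1: "d1 > 0" "\<And>x. norm (x - x0) < d1 \<Longrightarrow>
        norm (q x - q x0 - q' (x - x0)) \<le> e1 * norm (x - x0)"
      using q' e1 unfolding has_derivative_at_alt by blast
    obtain d2 where d2: "d2 > 0" "\<And>z. norm (z - (x0, u x0)) < d2 \<Longrightarrow>
        norm (g z - g (x0, u x0) - g' (z - (x0, u x0))) \<le> e1 * norm (z - (x0, u x0))"
      using g' e1 unfolding has_derivative_at_alt by blast
    define d where "d = Min {d0, d1, d2 / (1 + L)}"
    have "d > 0" using d0 d1 d2 L by (simp add: d_def)
    moreover have "norm (u x - u x0 - u' (x - x0)) \<le> e * norm (x - x0)" if x: "norm (x - x0) < d" for x
    proof -
      define h where "h = x - x0"
      define v where "v = u x - u x0"
      have hd: "norm h < d0" "norm h < d1" "norm h * (1 + L) < d2"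
        using x L by (simp_all add: d_def h_def pos_less_divide_eq)
      have v: "norm (h, v) \<le> (1 + L) * norm h"
        using u_lip[of x] hd norm_Pair_le[of h v] by (simp add: h_def v_def algebra_simps)
      have zz: "(x, u x) - (x0, u x0) = (h, v)" by (simp add: h_def v_def)
      have "norm ((x, u x) - (x0, u x0)) < d2" unfolding zz using v hd by (simp add: mult.commute)
      note r2 = d2(2)[OF this, unfolded zz eq]
      have "g' (h, v) = g' (h, 0) + g' (0, v)" by (simp flip: g'.add)
      then have "u x - u x0 - u' h = B (g' (h, v) - q' h)"
        by (simp add: u'_def BA B.add B.diff v_def algebra_simps)
      \<comment> \<open>Inserting \<open>q x - q x0\<close>, which is also the increment of
        \<open>g\<close> along the graph of \<open>u\<close>, exposes the two Taylor
        remainders.\<close>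
      also have "\<dots> = B ((q x - q x0 - q' h) - (q x - q x0 - g' (h, v)))" by simp
      finally have "norm (u x - u x0 - u' h) = norm \<dots>" by (rule arg_cong)
      also have "\<dots> \<le> norm ((q x - q x0 - q' h) - (q x - q x0 - g' (h, v))) * Kb"
        by (rule Kb)
      also have "\<dots> \<le> (e1 * norm h + e1 * ((1 + L) * norm h)) * Kb"
      proof (rule mult_right_mono[OF order_trans[OF norm_triangle_ineq4 add_mono]])
        show "norm (q x - q x0 - q' h) \<le> e1 * norm h" using d1 hd by (simp add: h_def)
        show "norm (q x - q x0 - g' (h, v)) \<le> e1 * ((1 + L) * norm h)"
          using r2 v e1 by (meson mult_left_mono order_trans less_imp_le)
      qed (use Kb in simp)
      also have "\<dots> = (e1 * (Kb * (2 + L))) * norm h" by (simp add: algebra_simps)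
      also have "e1 * (Kb * (2 + L)) = e" using Kb(1) L by (simp add: e1_def)
      finally show ?thesis by (simp add: h_def)
    qed
    ultimately show "\<exists>d>0. \<forall>y. norm (y - x0) < d \<longrightarrow> norm (u y - u x0 - u' (y - x0)) \<le> e * norm (y - x0)"
      by blast
  qed
  then show ?thesis by (auto simp: differentiable_def)
qed

section \<open>Uniform derivative bounds\<close>

definition unif_bounded :: "'i set \<Rightarrow> ('i \<Rightarrow> 'a \<Rightarrow> 'b::real_normed_vector) \<Rightarrow> bool" where
  "unif_bounded I F \<longleftrightarrow> (\<exists>M. \<forall>i\<in>I. \<forall>x. norm (F i x) \<le> M)"

abbreviation dir_deriv :: "'a::real_normed_vector \<Rightarrow> ('i \<Rightarrow> 'a \<Rightarrow> 'b::real_normed_vector) \<Rightarrow> 'i \<Rightarrow> 'a \<Rightarrow> 'b"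
  where "dir_deriv v F \<equiv> \<lambda>i x. frechet_derivative (F i) (at x) v"

text \<open>
  Uniform \<open>C\<^sup>n\<close> bounds for a family \<open>F i\<close>, \<open>i \<in> I\<close>; \<open>derivs_bounded\<close> leaves out the order \<open>0\<close>,
  because \<open>\<gamma>\<close> itself may be unbounded.  A bound that decays in \<open>\<epsilon>\<close> is expressed by a uniform
  bound for the rescaled family.
\<close>

primrec derivs_bounded ::
    "nat \<Rightarrow> 'i set \<Rightarrow> ('i \<Rightarrow> 'a::euclidean_space \<Rightarrow> 'b::real_normed_vector) \<Rightarrow> bool" where
  "derivs_bounded 0 I F \<longleftrightarrow> True"
| "derivs_bounded (Suc n) I F \<longleftrightarrow>
     (\<forall>i\<in>I. \<forall>x. F i differentiable (at x)) \<and>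
     (\<forall>v\<in>Basis. unif_bounded I (dir_deriv v F) \<and> derivs_bounded n I (dir_deriv v F))"

definition C_bounded ::
    "nat \<Rightarrow> 'i set \<Rightarrow> ('i \<Rightarrow> 'a::euclidean_space \<Rightarrow> 'b::real_normed_vector) \<Rightarrow> bool" where
  "C_bounded n I F \<longleftrightarrow> unif_bounded I F \<and> derivs_bounded n I F"

lemma unif_boundedI: "(\<And>i x. i \<in> I \<Longrightarrow> norm (F i x) \<le> M) \<Longrightarrow> unif_bounded I F"
  by (auto simp: unif_bounded_def)

lemma unif_boundedE:
  assumes "unif_bounded I F"
  obtains M where "M > 0" "\<And>i x. i \<in> I \<Longrightarrow> norm (F i x) \<le> M"
proof -
  obtain M where M: "\<And>i x. i \<in> I \<Longrightarrow> norm (F i x) \<le> M"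
    using assms by (auto simp: unif_bounded_def)
  then have "norm (F i x) \<le> max M 1" if "i \<in> I" for i x using that by (simp add: le_max_iff_disj)
  then show thesis by (intro that[of "max M 1"]) auto
qed

lemma unif_bounded_cong:
  "(\<And>i x. i \<in> I \<Longrightarrow> F i x = G i x) \<Longrightarrow> unif_bounded I F \<longleftrightarrow> unif_bounded I G"
  by (auto simp: unif_bounded_def)

lemma derivs_bounded_cong:
  assumes "\<And>i x. i \<in> I \<Longrightarrow> F i x = G i x"
  shows "derivs_bounded n I F \<longleftrightarrow> derivs_bounded n I G"
  using assms
proof (induction n arbitrary: F G)
  case (Suc n)
  have eq: "F i = G i" if "i \<in> I" for i using Suc.prems[OF that] by auto
  have "derivs_bounded n I (dir_deriv v F) \<longleftrightarrow> derivs_bounded n I (dir_deriv v G)" for v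
    by (rule Suc.IH) (simp add: eq)
  moreover have "unif_bounded I (dir_deriv v F) \<longleftrightarrow> unif_bounded I (dir_deriv v G)" for v
    by (rule unif_bounded_cong) (simp add: eq)
  ultimately show ?case by (simp add: eq)
qed simp

lemma C_bounded_cong:
  "(\<And>i x. i \<in> I \<Longrightarrow> F i x = G i x) \<Longrightarrow> C_bounded n I F \<longleftrightarrow> C_bounded n I G"
  unfolding C_bounded_def using derivs_bounded_cong[of I F G] unif_bounded_cong[of I F G] by auto

lemma derivs_bounded_Suc_iff:
  "derivs_bounded (Suc n) I F \<longleftrightarrow>
     (\<forall>i\<in>I. \<forall>x. F i differentiable (at x)) \<and> (\<forall>v\<in>Basis. C_bounded n I (dir_deriv v F))"
  by (auto simp: C_bounded_def)

lemma derivs_bounded_SucI: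
  assumes D: "\<And>i x. i \<in> I \<Longrightarrow> (F i has_derivative F' i x) (at x)"
    and C: "\<And>v. v \<in> Basis \<Longrightarrow> C_bounded n I (\<lambda>i x. F' i x v)"
  shows "derivs_bounded (Suc n) I F"
  unfolding derivs_bounded_Suc_iff
proof (intro conjI ballI allI)
  show "F i differentiable (at x)" if "i \<in> I" for i x
    using D[OF that] by (auto simp: differentiable_def)
  show "C_bounded n I (dir_deriv v F)" if v: "v \<in> Basis" for v
    using C[OF v] by (rule C_bounded_cong[THEN iffD1, rotated]) (simp add: frechet_derivative_at[OF D, symmetric])
qed

lemma derivs_boundedD:
  assumes "derivs_bounded (Suc n) I F"
  shows "i \<in> I \<Longrightarrow> (F i has_derivative frechet_derivative (F i) (at x)) (at x)"
    and "v \<in> Basis \<Longrightarrow> C_bounded n I (dir_deriv v F)"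
  using assms unfolding derivs_bounded_Suc_iff by (auto simp: frechet_derivative_works[symmetric])

lemma derivs_bounded_antimono: "derivs_bounded n I F \<Longrightarrow> m \<le> n \<Longrightarrow> derivs_bounded m I F"
proof (induction n arbitrary: m F)
  case (Suc n)
  then show ?case by (cases m) auto
qed simp

lemma C_bounded_antimono: "C_bounded n I F \<Longrightarrow> m \<le> n \<Longrightarrow> C_bounded m I F"
  by (auto simp: C_bounded_def intro: derivs_bounded_antimono)

lemma C_bounded_Suc_iff: "C_bounded (Suc n) I F \<longleftrightarrow> unif_bounded I F \<and> derivs_bounded (Suc n) I F"
  by (rule C_bounded_def)

declare derivs_bounded.simps(2) [simp del]

section \<open>Closure of uniform bounds under linear maps, sums, products and composition\<close>

lemma unif_bounded_linear:
  assumes "bounded_linear L" "unif_bounded I F"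
  shows "unif_bounded I (\<lambda>i x. L (F i x))"
proof -
  obtain M where M: "\<And>i x. i \<in> I \<Longrightarrow> norm (F i x) \<le> M" using assms(2) unfolding unif_bounded_def by blast
  obtain N where N: "N > 0" "\<And>y. norm (L y) \<le> norm y * N"
    using bounded_linear.pos_bounded[OF assms(1)] by blast
  show ?thesis
  proof (rule unif_boundedI)
    show "norm (L (F i x)) \<le> M * N" if "i \<in> I" for i x
      using N(2)[of "F i x"] mult_right_mono[OF M[OF that, of x], of N] N(1) by linarith
  qed
qed

lemma derivs_bounded_affine:
  fixes F :: "'i \<Rightarrow> 'a::euclidean_space \<Rightarrow> 'b::real_normed_vector"
  assumes L: "bounded_linear L"
  shows "derivs_bounded n I F \<Longrightarrow> derivs_bounded n I (\<lambda>i x. c i + L (F i x))"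
proof (induction n arbitrary: F c)
  case (Suc n)
  show ?case
  proof (rule derivs_bounded_SucI)
    fix i x assume "i \<in> I"
    then show "((\<lambda>x. c i + L (F i x)) has_derivative (\<lambda>v. L (frechet_derivative (F i) (at x) v))) (at x)"
      using bounded_linear.has_derivative[OF L derivs_boundedD(1)[OF Suc.prems]] 
      by (auto intro!: derivative_eq_intros)
  next
    fix v :: 'a assume v: "v \<in> Basis"
    note D = derivs_boundedD(2)[OF Suc.prems v]
    show "C_bounded n I (\<lambda>i x. L (dir_deriv v F i x))"
      using D Suc.IH[of "dir_deriv v F" "\<lambda>_. 0"] unif_bounded_linear[OF L]
      by (auto simp: C_bounded_def)
  qed
qed simp

lemma C_bounded_linear:
  assumes "bounded_linear L" "C_bounded n I F"
  shows "C_bounded n I (\<lambda>i x. L (F i x))"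
  using assms derivs_bounded_affine[of L n I F "\<lambda>_. 0"] unif_bounded_linear[of L I F]
  by (auto simp: C_bounded_def)

lemma unif_bounded_add:
  assumes "unif_bounded I F" "unif_bounded I G"
  shows "unif_bounded I (\<lambda>i x. F i x + G i x)"
proof -
  obtain M where M: "\<And>i x. i \<in> I \<Longrightarrow> norm (F i x) \<le> M" using assms(1) unfolding unif_bounded_def by blast
  obtain N where N: "\<And>i x. i \<in> I \<Longrightarrow> norm (G i x) \<le> N" using assms(2) unfolding unif_bounded_def by blast
  show ?thesis
    by (rule unif_boundedI[of _ _ "M + N"]) (meson M N norm_triangle_mono)
qed

lemma derivs_bounded_add:
  fixes F G :: "'i \<Rightarrow> 'a::euclidean_space \<Rightarrow> 'b::real_normed_vector"
  shows "derivs_bounded n I F \<Longrightarrow> derivs_bounded n I G \<Longrightarrow> derivs_bounded n I (\<lambda>i x. F i x + G i x)"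
proof (induction n arbitrary: F G)
  case (Suc n)
  show ?case
  proof (rule derivs_bounded_SucI)
    fix i x assume "i \<in> I"
    then show "((\<lambda>x. F i x + G i x) has_derivative (\<lambda>v. dir_deriv v F i x + dir_deriv v G i x)) (at x)"
      by (intro has_derivative_add Suc.prems[THEN derivs_boundedD(1)])
  next
    fix v :: 'a assume v: "v \<in> Basis"
    show "C_bounded n I (\<lambda>i x. dir_deriv v F i x + dir_deriv v G i x)"
      using Suc.prems[THEN derivs_boundedD(2), OF v] Suc.IH by (auto simp: C_bounded_def unif_bounded_add)
  qed
qed simp

lemma C_bounded_add:
  "C_bounded n I F \<Longrightarrow> C_bounded n I G \<Longrightarrow> C_bounded n I (\<lambda>i x. F i x + G i x)"
  by (auto simp: C_bounded_def unif_bounded_add derivs_bounded_add)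

lemma C_bounded_diff:
  "C_bounded n I F \<Longrightarrow> C_bounded n I G \<Longrightarrow> C_bounded n I (\<lambda>i x. F i x - G i x)"
  using C_bounded_add[of n I F "\<lambda>i x. - G i x"]
    C_bounded_linear[OF bounded_linear_minus[OF bounded_linear_ident], of n I G] by simp

lemma C_bounded_zero:
  "C_bounded n I (\<lambda>i x. 0)"
proof -
  have "derivs_bounded n I (\<lambda>i (x::'b). 0 :: 'c)"
    by (induction n) (auto simp: unif_bounded_def derivs_bounded.simps(2))
  then show ?thesis by (auto simp: C_bounded_def unif_bounded_def)
qed

lemma C_bounded_sum:
  "finite S \<Longrightarrow> (\<And>s. s \<in> S \<Longrightarrow> C_bounded n I (F s)) \<Longrightarrow> C_bounded n I (\<lambda>i x. \<Sum>s\<in>S. F s i x)"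
  by (induction S rule: finite_induct) (auto simp: C_bounded_zero C_bounded_add)

lemma unif_bounded_scaleR:
  assumes "unif_bounded I a" "unif_bounded I F"
  shows "unif_bounded I (\<lambda>i x. a i x *\<^sub>R F i x)"
proof -
  obtain M where M: "M > 0" "\<And>i x. i \<in> I \<Longrightarrow> norm (a i x) \<le> M" using unif_boundedE[OF assms(1)] by metis
  obtain N where N: "\<And>i x. i \<in> I \<Longrightarrow> norm (F i x) \<le> N" using assms(2) unfolding unif_bounded_def by blast
  show ?thesis
    by (rule unif_boundedI[of _ _ "M * N"]) (use M N in \<open>auto intro!: mult_mono\<close>)
qed

text \<open>The product rule leaves each factor undifferentiated in one term, so order 0 has to be
  bounded for both factors.\<close>

lemma C_bounded_scaleR:
  fixes F :: "'i \<Rightarrow> 'a::euclidean_space \<Rightarrow> 'b::real_normed_vector"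
  shows "C_bounded n I a \<Longrightarrow> C_bounded n I F \<Longrightarrow> C_bounded n I (\<lambda>i x. a i x *\<^sub>R F i x)"
proof (induction n arbitrary: a F)
  case 0
  then show ?case by (auto simp: C_bounded_def unif_bounded_scaleR)
next
  case (Suc n)
  note a = Suc.prems(1) and F = Suc.prems(2)
  have "derivs_bounded (Suc n) I (\<lambda>i x. a i x *\<^sub>R F i x)"
  proof (rule derivs_bounded_SucI)
    fix i x assume "i \<in> I"
    then show "((\<lambda>x. a i x *\<^sub>R F i x) has_derivative
        (\<lambda>v. a i x *\<^sub>R dir_deriv v F i x + dir_deriv v a i x *\<^sub>R F i x)) (at x)"
      using a F by (intro has_derivative_scaleR) (auto simp: C_bounded_Suc_iff derivs_boundedD)
  next
    fix v :: 'a assume v: "v \<in> Basis"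
    have "C_bounded n I a" "C_bounded n I F" using a F by (auto intro: C_bounded_antimono)
    moreover have "C_bounded n I (dir_deriv v a)" "C_bounded n I (dir_deriv v F)"
      using a F v by (auto simp: C_bounded_Suc_iff derivs_boundedD)
    ultimately show "C_bounded n I (\<lambda>i x. a i x *\<^sub>R dir_deriv v F i x + dir_deriv v a i x *\<^sub>R F i x)"
      by (intro C_bounded_add Suc.IH)
  qed
  then show ?case using a F by (auto simp: C_bounded_def unif_bounded_scaleR)
qed

lemma linear_basis_expansion:
  assumes "linear L"
  shows "L x = (\<Sum>b\<in>Basis. (x \<bullet> b) *\<^sub>R L b)"
proof -
  have "L x = L (\<Sum>b\<in>Basis. (x \<bullet> b) *\<^sub>R b)" by (simp add: euclidean_representation)
  also have "\<dots> = (\<Sum>b\<in>Basis. (x \<bullet> b) *\<^sub>R L b)" using assms by (simp add: linear_sum linear_scale)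
  finally show ?thesis .
qed

text \<open>Induction on the order avoids the higher chain rule: a directional derivative of the
  composite is a sum of products of components of the derivative of \<open>u\<close> with partial
  derivatives of \<phi> composed with \<open>u\<close>, and the latter fall under the induction
  hypothesis. Boundedness comes from \<phi>, so \<open>u\<close> itself may be unbounded.\<close>

lemma C_bounded_compose:
  fixes \<phi> :: "'i \<Rightarrow> 'b::euclidean_space \<Rightarrow> 'c::real_normed_vector"
    and u :: "'i \<Rightarrow> 'a::euclidean_space \<Rightarrow> 'b"
  shows "C_bounded n I \<phi> \<Longrightarrow> derivs_bounded n I u \<Longrightarrow> C_bounded n I (\<lambda>i x. \<phi> i (u i x))"
proof (induction n arbitrary: \<phi> u)
  case 0
  then show ?case by (auto simp: C_bounded_def unif_bounded_def)
next
  case (Suc n)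
  note \<phi> = Suc.prems(1)[unfolded C_bounded_Suc_iff, THEN conjunct2] and u = Suc.prems(2)
  have "derivs_bounded (Suc n) I (\<lambda>i x. \<phi> i (u i x))"
  proof (rule derivs_bounded_SucI)
    fix i x assume i: "i \<in> I"
    show "((\<lambda>x. \<phi> i (u i x)) has_derivative
        (\<lambda>v. frechet_derivative (\<phi> i) (at (u i x)) (dir_deriv v u i x))) (at x)"
      using has_derivative_compose[OF derivs_boundedD(1)[OF u i] derivs_boundedD(1)[OF \<phi> i]] .
  next
    fix v :: 'a assume v: "v \<in> Basis"
    have eq: "frechet_derivative (\<phi> i) (at (u i x)) (dir_deriv v u i x) =
        (\<Sum>c\<in>Basis. (dir_deriv v u i x \<bullet> c) *\<^sub>R dir_deriv c \<phi> i (u i x))" if "i \<in> I" for i x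
      by (rule linear_basis_expansion[OF has_derivative_linear[OF derivs_boundedD(1)[OF \<phi> that]]])
    have "C_bounded n I (\<lambda>i x. \<Sum>c\<in>Basis. (dir_deriv v u i x \<bullet> c) *\<^sub>R dir_deriv c \<phi> i (u i x))"
      using derivs_boundedD(2)[OF \<phi>] derivs_boundedD(2)[OF u v] derivs_bounded_antimono[OF u, of n]
      by (intro C_bounded_sum C_bounded_scaleR Suc.IH C_bounded_linear[OF bounded_linear_inner_left]) auto
    then show "C_bounded n I (\<lambda>i x. frechet_derivative (\<phi> i) (at (u i x)) (dir_deriv v u i x))"
      by (rule C_bounded_cong[THEN iffD1, rotated]) (simp add: eq)
  qed
  then show ?case using Suc.prems(1) by (auto simp: C_bounded_def unif_bounded_def)
qed

section \<open>Lipschitz bounds and weighted differences\<close>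

lemma derivs_bounded_imp_Lipschitz:
  assumes "derivs_bounded (Suc 0) I \<phi>"
  obtains L where "L > 0" "\<And>i x y. i \<in> I \<Longrightarrow> norm (\<phi> i x - \<phi> i y) \<le> L * norm (x - y)"
    "\<And>i x v. i \<in> I \<Longrightarrow> norm (frechet_derivative (\<phi> i) (at x) v) \<le> L * norm v"
proof -
  have "\<forall>v\<in>Basis. \<exists>M. \<forall>i\<in>I. \<forall>x. norm (dir_deriv v \<phi> i x) \<le> M"
    using derivs_boundedD(2)[OF assms] by (auto simp: C_bounded_def unif_bounded_def)
  then obtain M where M: "\<And>v i x. v \<in> Basis \<Longrightarrow> i \<in> I \<Longrightarrow> norm (dir_deriv v \<phi> i x) \<le> M v"
    by metis
  define L where "L = 1 + (\<Sum>v\<in>Basis. \<bar>M v\<bar>)"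
  have L: "L > 0" by (simp add: L_def sum_nonneg add_pos_nonneg)
  have der: "norm (frechet_derivative (\<phi> i) (at x) v) \<le> L * norm v" if "i \<in> I" for i x v
  proof -
    have "norm (frechet_derivative (\<phi> i) (at x) v) = norm (\<Sum>b\<in>Basis. (v \<bullet> b) *\<^sub>R dir_deriv b \<phi> i x)"
      using linear_basis_expansion[OF has_derivative_linear[OF derivs_boundedD(1)[OF assms that]]] by metis
    also have "\<dots> \<le> (\<Sum>b\<in>Basis. norm v * \<bar>M b\<bar>)"
    proof (rule order_trans[OF norm_sum sum_mono])
      fix b :: 'b assume b: "b \<in> Basis"
      have "norm (dir_deriv b \<phi> i x) \<le> \<bar>M b\<bar>" using M[OF b that, of x] by linarith
      then show "norm ((v \<bullet> b) *\<^sub>R dir_deriv b \<phi> i x) \<le> norm v * \<bar>M b\<bar>"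
        using Basis_le_norm[OF b, of v] by (auto intro!: mult_mono)
    qed
    also have "\<dots> \<le> L * norm v"
      by (simp add: L_def sum_distrib_left[symmetric] algebra_simps)
    finally show ?thesis .
  qed
  have "norm (\<phi> i x - \<phi> i y) \<le> L * norm (x - y)" if "i \<in> I" for i x y
  proof (rule differentiable_bound[of UNIV])
    show "onorm (frechet_derivative (\<phi> i) (at z)) \<le> L" for z
      using der[OF that, of z] L by (intro onorm_bound) auto
  qed (use derivs_boundedD(1)[OF assms that] in auto)
  then show thesis using L der that by blast
qed

lemma unif_bounded_compose_diff:
  assumes \<phi>: "derivs_bounded (Suc 0) I \<phi>"
    and w: "unif_bounded I (\<lambda>i x. w i *\<^sub>R (u i x - v i x))"
  shows "unif_bounded I (\<lambda>i x. w i *\<^sub>R (\<phi> i (u i x) - \<phi> i (v i x)))"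
proof -
  obtain L where L: "L > 0" "\<And>i x y. i \<in> I \<Longrightarrow> norm (\<phi> i x - \<phi> i y) \<le> L * norm (x - y)"
    using derivs_bounded_imp_Lipschitz[OF \<phi>] by metis
  obtain M where M: "M > 0" "\<And>i x. i \<in> I \<Longrightarrow> norm (w i *\<^sub>R (u i x - v i x)) \<le> M"
    using unif_boundedE[OF w] by metis
  show ?thesis
  proof (rule unif_boundedI)
    fix i x assume i: "i \<in> I"
    have "norm (w i *\<^sub>R (\<phi> i (u i x) - \<phi> i (v i x))) \<le> \<bar>w i\<bar> * (L * norm (u i x - v i x))"
      using L(2)[OF i] by (simp add: mult_left_mono)
    also have "\<dots> = L * norm (w i *\<^sub>R (u i x - v i x))" by simp
    also have "\<dots> \<le> L * M" using M(2)[OF i] L(1) by (intro mult_left_mono) auto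
    finally show "norm (w i *\<^sub>R (\<phi> i (u i x) - \<phi> i (v i x))) \<le> L * M" .
  qed
qed

lemma dir_deriv_scaled_diff:
  assumes "derivs_bounded (Suc n) I u" "derivs_bounded (Suc n) I v" "i \<in> I"
  shows "dir_deriv b (\<lambda>i x. w i *\<^sub>R (u i x - v i x)) i x = w i *\<^sub>R (dir_deriv b u i x - dir_deriv b v i x)"
proof -
  have "((\<lambda>x. w i *\<^sub>R (u i x - v i x)) has_derivative
      (\<lambda>b. w i *\<^sub>R (dir_deriv b u i x - dir_deriv b v i x))) (at x)"
    by (intro has_derivative_scaleR_right has_derivative_diff derivs_boundedD(1)[OF assms(1,3)]
        derivs_boundedD(1)[OF assms(2,3)])
  from fun_cong[OF frechet_derivative_at[OF this], of b] show ?thesis by (rule sym)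
qed

text \<open>The top-order derivatives of \<phi> enter as a difference at \<open>u\<close> and
  \<open>v\<close>, which a Lipschitz bound must control; hence order \<open>Suc n\<close> of \<phi>
  for order \<open>n\<close> of the result. The weight \<open>w i\<close> later becomes a negative
  power of \<epsilon>, so it may stand only in front of factors that are themselves
  differences.\<close>

lemma C_bounded_compose_diff:
  fixes \<phi> :: "'i \<Rightarrow> 'b::euclidean_space \<Rightarrow> 'c::real_normed_vector"
    and u v :: "'i \<Rightarrow> 'a::euclidean_space \<Rightarrow> 'b"
  shows "derivs_bounded (Suc n) I \<phi> \<Longrightarrow> derivs_bounded n I u \<Longrightarrow> derivs_bounded n I v \<Longrightarrow>
    C_bounded n I (\<lambda>i x. w i *\<^sub>R (u i x - v i x)) \<Longrightarrow>
    C_bounded n I (\<lambda>i x. w i *\<^sub>R (\<phi> i (u i x) - \<phi> i (v i x)))"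
proof (induction n arbitrary: \<phi>)
  case 0
  then show ?case using unif_bounded_compose_diff by (auto simp: C_bounded_def)
next
  case (Suc n)
  note \<phi> = Suc.prems(1) and u = Suc.prems(2) and v = Suc.prems(3) and w = Suc.prems(4)
  have un: "derivs_bounded n I u" and vn: "derivs_bounded n I v"
    by (rule derivs_bounded_antimono[OF u] derivs_bounded_antimono[OF v], simp)+
  have wn: "C_bounded n I (\<lambda>i x. w i *\<^sub>R (u i x - v i x))"
    by (rule C_bounded_antimono[OF w]) simp
  have dw: "C_bounded n I (\<lambda>i x. w i *\<^sub>R (dir_deriv b u i x - dir_deriv b v i x))" if "b \<in> Basis" for b
    using derivs_boundedD(2)[OF w[unfolded C_bounded_Suc_iff, THEN conjunct2] that]
    by (rule C_bounded_cong[THEN iffD1, rotated]) (rule dir_deriv_scaled_diff[OF u v])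
  have "derivs_bounded (Suc n) I (\<lambda>i x. w i *\<^sub>R (\<phi> i (u i x) - \<phi> i (v i x)))"
  proof (rule derivs_bounded_SucI)
    fix i x assume i: "i \<in> I"
    show "((\<lambda>x. w i *\<^sub>R (\<phi> i (u i x) - \<phi> i (v i x))) has_derivative
        (\<lambda>b. w i *\<^sub>R (frechet_derivative (\<phi> i) (at (u i x)) (dir_deriv b u i x) -
                    frechet_derivative (\<phi> i) (at (v i x)) (dir_deriv b v i x)))) (at x)"
      by (intro has_derivative_scaleR_right has_derivative_diff
          has_derivative_compose[OF derivs_boundedD(1)[OF u i] derivs_boundedD(1)[OF \<phi> i]]
          has_derivative_compose[OF derivs_boundedD(1)[OF v i] derivs_boundedD(1)[OF \<phi> i]])
  next
    fix b :: 'a assume b: "b \<in> Basis"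
    \<comment> \<open>The splitting aA - bB = a(A - B) + (a - b)B in each basis direction puts the
      weight on exactly one difference per product.\<close>
    have eq: "w i *\<^sub>R (frechet_derivative (\<phi> i) (at (u i x)) (dir_deriv b u i x) -
                    frechet_derivative (\<phi> i) (at (v i x)) (dir_deriv b v i x)) =
        (\<Sum>c\<in>Basis. (dir_deriv b u i x \<bullet> c) *\<^sub>R (w i *\<^sub>R (dir_deriv c \<phi> i (u i x) - dir_deriv c \<phi> i (v i x)))
          + ((w i *\<^sub>R (dir_deriv b u i x - dir_deriv b v i x)) \<bullet> c) *\<^sub>R dir_deriv c \<phi> i (v i x))"
      if "i \<in> I" for i x
      unfolding linear_basis_expansion[OF has_derivative_linear[OF derivs_boundedD(1)[OF \<phi> that]],
          of _ "dir_deriv b u i x"]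
        linear_basis_expansion[OF has_derivative_linear[OF derivs_boundedD(1)[OF \<phi> that]],
          of _ "dir_deriv b v i x"]
      by (simp add: inner_diff_left scaleR_diff_left scaleR_diff_right sum_subtractf scaleR_sum_right
          sum.distrib mult.commute)
    have "C_bounded n I (\<lambda>i x. \<Sum>c\<in>Basis.
          (dir_deriv b u i x \<bullet> c) *\<^sub>R (w i *\<^sub>R (dir_deriv c \<phi> i (u i x) - dir_deriv c \<phi> i (v i x)))
          + ((w i *\<^sub>R (dir_deriv b u i x - dir_deriv b v i x)) \<bullet> c) *\<^sub>R dir_deriv c \<phi> i (v i x))"
      by (intro C_bounded_sum C_bounded_add C_bounded_scaleR Suc.IH un vn wn
          C_bounded_linear[OF bounded_linear_inner_left] dw b C_bounded_compose[OF _ vn]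
          derivs_boundedD(2)[OF u b] C_bounded_antimono[OF derivs_boundedD(2)[OF \<phi>]])
        (use derivs_boundedD(2)[OF \<phi>] in \<open>auto simp: C_bounded_Suc_iff\<close>)
    then show "C_bounded n I (\<lambda>i x. w i *\<^sub>R (frechet_derivative (\<phi> i) (at (u i x)) (dir_deriv b u i x) -
                    frechet_derivative (\<phi> i) (at (v i x)) (dir_deriv b v i x)))"
      by (rule C_bounded_cong[THEN iffD1, rotated]) (simp only: eq)
  qed
  moreover have "unif_bounded I (\<lambda>i x. w i *\<^sub>R (\<phi> i (u i x) - \<phi> i (v i x)))"
    by (rule unif_bounded_compose_diff[OF derivs_bounded_antimono[OF \<phi>]]) (use w in \<open>simp_all add: C_bounded_def\<close>)
  ultimately show ?case by (simp add: C_bounded_def)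
qed

section \<open>Regularity of dissipative implicit functions\<close>

text \<open>With \<open>a c i x\<close> as the columns of a matrix A, the equation reads A u = b.
  Differentiating gives A u_v = b_v - A_v u: the matrix is unchanged, and the new right-hand side
  has one order less and contains \<open>u\<close> only to an order already bounded. So the
  induction on the order can leave the matrix fixed while \<open>b\<close> and \<open>u\<close>
  vary.\<close>

lemma C_bounded_dissipative_system:
  fixes a :: "'b \<Rightarrow> 'i \<Rightarrow> 'a::euclidean_space \<Rightarrow> 'b::euclidean_space"
  assumes beta: "\<beta> > 0"
    and diss: "\<And>i x w. i \<in> I \<Longrightarrow> (\<Sum>c\<in>Basis. (w \<bullet> c) *\<^sub>R a c i x) \<bullet> w \<le> - \<beta> * (norm w)\<^sup>2"
  shows "(\<And>c. c \<in> Basis \<Longrightarrow> C_bounded n I (a c)) \<Longrightarrow> C_bounded n I b \<Longrightarrow>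
    (\<And>i x. i \<in> I \<Longrightarrow> (\<Sum>c\<in>Basis. (u i x \<bullet> c) *\<^sub>R a c i x) = b i x) \<Longrightarrow> C_bounded n I u"
proof (induction n arbitrary: b u)
  case 0
  obtain M where M: "M > 0" "\<And>i x. i \<in> I \<Longrightarrow> norm (b i x) \<le> M"
    using 0(2) unif_boundedE unfolding C_bounded_def by metis
  have bd: "norm (u i x) \<le> M / \<beta>" if "i \<in> I" for i x
    using order_trans[OF norm_le_of_dissipative[OF beta diss[OF that, of "u i x" x], unfolded 0(3)[OF that]]
        M(2)[OF that, of x]] beta
    by (simp only: pos_le_divide_eq mult.commute)
  have "unif_bounded I u" by (rule unif_boundedI[OF bd])
  then show ?case by (simp add: C_bounded_def)
next
  case (Suc n)
  note a = Suc.prems(1)[unfolded C_bounded_Suc_iff, THEN conjunct2]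
    and b = Suc.prems(2)[unfolded C_bounded_Suc_iff, THEN conjunct2]
    and eq = Suc.prems(3)
  have un: "C_bounded n I u"
    using Suc.prems(3)
    by (intro Suc.IH[of b u] C_bounded_antimono[OF Suc.prems(1)] C_bounded_antimono[OF Suc.prems(2)]) auto
  have d: "u i differentiable (at x)" if i: "i \<in> I" for i x
  \<comment> \<open>The linear system is itself a dissipative implicit equation in \<open>w\<close>,
    so differentiability of \<open>u\<close> need not be presupposed.\<close>
  proof (rule implicit_differentiable[OF beta, of "\<lambda>(x, w). \<Sum>c\<in>Basis. (w \<bullet> c) *\<^sub>R a c i x" _ _ "b i"])
    show "((case (x, y) of (x, w) \<Rightarrow> \<Sum>c\<in>Basis. (w \<bullet> c) *\<^sub>R a c i x) -
        (case (x, y') of (x, w) \<Rightarrow> \<Sum>c\<in>Basis. (w \<bullet> c) *\<^sub>R a c i x)) \<bullet> (y - y') \<le> - \<beta> * (norm (y - y'))\<^sup>2"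
      for x y y'
      using diss[OF i, of "y - y'" x] by (simp add: inner_diff_left scaleR_left_diff_distrib sum_subtractf)
    have "(\<lambda>z. \<Sum>c\<in>Basis. (snd z \<bullet> c) *\<^sub>R a c i (fst z)) differentiable (at (x, u i x))"
    proof (intro differentiable_sum ballI differentiable_scaleR)
      fix c :: 'b assume c: "c \<in> Basis"
      show "(\<lambda>z. snd z \<bullet> c) differentiable (at (x, u i x))"
        unfolding differentiable_def
        by (rule exI, rule has_derivative_inner_left[OF has_derivative_snd[OF has_derivative_ident]])
      have "((\<lambda>z. a c i (fst z)) has_derivative (\<lambda>h. frechet_derivative (a c i) (at (fst (x, u i x))) (fst h))) (at (x, u i x))"
        by (rule has_derivative_compose[OF has_derivative_fst[OF has_derivative_ident] derivs_boundedD(1)[OF a[OF c] i]])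
      then show "(\<lambda>z. a c i (fst z)) differentiable (at (x, u i x))"
        by (rule differentiableI)
    qed simp
    then show "(\<lambda>(x, w). \<Sum>c\<in>Basis. (w \<bullet> c) *\<^sub>R a c i x) differentiable (at (x, u i x))"
      by (simp add: case_prod_beta')
    show "b i differentiable (at x)" unfolding differentiable_def by (rule exI, rule derivs_boundedD(1)[OF b i])
    show "(case (x, u i x) of (x, w) \<Rightarrow> \<Sum>c\<in>Basis. (w \<bullet> c) *\<^sub>R a c i x) = b i x" for x
      using eq[OF i] by simp
  qed
  have "C_bounded n I (dir_deriv v u)" if v: "v \<in> Basis" for v
  proof (rule Suc.IH)
    show "C_bounded n I (a c)" if "c \<in> Basis" for c
      by (rule C_bounded_antimono[OF Suc.prems(1)[OF that]]) simp
    show "C_bounded n I (\<lambda>i x. dir_deriv v b i x - (\<Sum>c\<in>Basis. (u i x \<bullet> c) *\<^sub>R dir_deriv v (a c) i x))"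
      by (intro C_bounded_diff C_bounded_sum C_bounded_scaleR derivs_boundedD(2)[OF b v]
          derivs_boundedD(2)[OF a v] C_bounded_linear[OF bounded_linear_inner_left] un) auto
    fix i x assume i: "i \<in> I"
    have "((\<lambda>x. \<Sum>c\<in>Basis. (u i x \<bullet> c) *\<^sub>R a c i x) has_derivative
        (\<lambda>v. \<Sum>c\<in>Basis. (u i x \<bullet> c) *\<^sub>R dir_deriv v (a c) i x + (dir_deriv v u i x \<bullet> c) *\<^sub>R a c i x)) (at x)"
      using d[OF i] by (intro has_derivative_sum has_derivative_scaleR derivs_boundedD(1)[OF a i]
          has_derivative_inner_left) (auto simp: frechet_derivative_works)
    moreover have "((\<lambda>x. \<Sum>c\<in>Basis. (u i x \<bullet> c) *\<^sub>R a c i x) has_derivative (\<lambda>v. dir_deriv v b i x)) (at x)"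
      using derivs_boundedD(1)[OF b i] by (simp add: eq[OF i])
    ultimately have "(\<Sum>c\<in>Basis. (u i x \<bullet> c) *\<^sub>R dir_deriv v (a c) i x + (dir_deriv v u i x \<bullet> c) *\<^sub>R a c i x)
        = dir_deriv v b i x"
      by (rule has_derivative_unique[THEN fun_cong])
    then show "(\<Sum>c\<in>Basis. (dir_deriv v u i x \<bullet> c) *\<^sub>R a c i x) =
        dir_deriv v b i x - (\<Sum>c\<in>Basis. (u i x \<bullet> c) *\<^sub>R dir_deriv v (a c) i x)"
      by (simp add: sum.distrib algebra_simps)
  qed
  then have "derivs_bounded (Suc n) I u" using d by (simp add: derivs_bounded_Suc_iff)
  then show ?case using un by (simp add: C_bounded_def)
qed

text \<open>The identity component is unbounded, but its derivative is constant; omitting order 0 is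
  what admits such inner functions in compositions.\<close>

lemma derivs_bounded_graph:
  fixes u :: "'i \<Rightarrow> 'a::euclidean_space \<Rightarrow> 'b::euclidean_space"
  assumes "derivs_bounded n I u"
  shows "derivs_bounded n I (\<lambda>i x. (x, u i x))"
proof (cases n)
  case (Suc m)
  show ?thesis unfolding Suc
  proof (rule derivs_bounded_SucI)
    fix i x assume i: "i \<in> I"
    show "((\<lambda>x. (x, u i x)) has_derivative (\<lambda>v. (v, dir_deriv v u i x))) (at x)"
      by (intro has_derivative_Pair has_derivative_ident derivs_boundedD(1)[OF assms[unfolded Suc] i])
  next
    fix v :: 'a assume v: "v \<in> Basis"
    have L: "bounded_linear (\<lambda>y. (0 :: 'a, y :: 'b))" 
      by (intro bounded_linear_Pair bounded_linear_zero bounded_linear_ident)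
    note D = derivs_boundedD(2)[OF assms[unfolded Suc] v]
    obtain M where M: "\<And>i x. i \<in> I \<Longrightarrow> norm (dir_deriv v u i x) \<le> M"
      using D unfolding C_bounded_def unif_bounded_def by blast
    have "unif_bounded I (\<lambda>i x. (v, dir_deriv v u i x))"
      by (rule unif_boundedI[of _ _ "norm v + M"]) (use M in \<open>meson norm_Pair_le order_trans add_left_mono\<close>)
    then show "C_bounded m I (\<lambda>i x. (v, dir_deriv v u i x))"
      using D derivs_bounded_affine[OF L, of m I "dir_deriv v u" "\<lambda>_. (v, 0)"] by (simp add: C_bounded_def)
  qed
qed simp

section \<open>Regularity and stability of the nonlinear implicit equation\<close>

locale dissipative =
  fixes g :: "'a::euclidean_space \<times> 'b::euclidean_space \<Rightarrow> 'b" and \<beta> :: real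
  assumes beta: "\<beta> > 0"
    and diss: "\<And>x y y'. (g (x, y) - g (x, y')) \<bullet> (y - y') \<le> - \<beta> * (norm (y - y'))\<^sup>2"
begin

lemma dissipative_partials:
  assumes "g differentiable (at (x, y))"
  shows "(\<Sum>c\<in>Basis. (w \<bullet> c) *\<^sub>R frechet_derivative g (at (x, y)) (0, c)) \<bullet> w \<le> - \<beta> * (norm w)\<^sup>2"
proof -
  have g': "(g has_derivative frechet_derivative g (at (x, y))) (at (x, y))"
    using assms by (simp add: frechet_derivative_works)
  interpret g': bounded_linear "frechet_derivative g (at (x, y))" using g' by (rule has_derivative_bounded_linear)
  have "linear (\<lambda>w. frechet_derivative g (at (x, y)) (0, w))"
    by (rule linearI) (simp_all flip: g'.add g'.scaleR)
  from linear_basis_expansion[OF this, of w] show ?thesis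
    using dissipative_derivative[OF diss g', of w] by simp
qed

text \<open>The differentiated implicit equation, written by columns so that it is a system of the
  kind treated in \<open>C_bounded_dissipative_system\<close>.\<close>

lemma implicit_derivative_eq:
  assumes g: "g differentiable (at (x, u x))"
    and u: "(u has_derivative u') (at x)" and q: "(q has_derivative q') (at x)"
    and eq: "\<And>x. g (x, u x) = q x"
  shows "(\<Sum>c\<in>Basis. (u' v \<bullet> c) *\<^sub>R frechet_derivative g (at (x, u x)) (0, c)) =
    q' v - frechet_derivative g (at (x, u x)) (v, 0)"
proof -
  have g': "(g has_derivative frechet_derivative g (at (x, u x))) (at (x, u x))"
    using g by (simp add: frechet_derivative_works)
  interpret g': bounded_linear "frechet_derivative g (at (x, u x))" using g' by (rule has_derivative_bounded_linear)
  have "((\<lambda>x. g (x, u x)) has_derivative (\<lambda>v. frechet_derivative g (at (x, u x)) (v, u' v))) (at x)"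
    using has_derivative_compose[OF has_derivative_Pair[OF has_derivative_ident u] g'] .
  then have "q' = (\<lambda>v. frechet_derivative g (at (x, u x)) (v, u' v))"
    unfolding eq by (rule has_derivative_unique[OF q])
  then have "q' v = frechet_derivative g (at (x, u x)) (v, 0) + frechet_derivative g (at (x, u x)) (0, u' v)"
    by (simp flip: g'.add)
  moreover have "linear (\<lambda>w. frechet_derivative g (at (x, u x)) (0, w))"
    by (rule linearI) (simp_all flip: g'.add g'.scaleR)
  ultimately show ?thesis
    using linear_basis_expansion[of "\<lambda>w. frechet_derivative g (at (x, u x)) (0, w)" "u' v"] by simp
qed

text \<open>Bootstrap: \<open>n\<close> orders of \<open>u\<close> give the coefficients of the
  linearised equation \<open>n\<close> orders, and its solution, a directional derivative of
  \<open>u\<close>, inherits them.\<close>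

lemma derivs_bounded_implicit_step:
  assumes g: "derivs_bounded (Suc n) I (\<lambda>_. g)" and q: "derivs_bounded (Suc n) I q"
    and u: "derivs_bounded n I u"
    and eq: "\<And>i x. i \<in> I \<Longrightarrow> g (x, u i x) = q i x"
  shows "derivs_bounded (Suc n) I u"
proof -
  have dg: "g differentiable (at z)" if "i \<in> I" for i z
    using derivs_boundedD(1)[OF g that, of z] unfolding differentiable_def by blast
  have d: "u i differentiable (at x)" if i: "i \<in> I" for i x
  proof (rule implicit_differentiable[OF beta diss dg[OF i] _ eq[OF i]])
    show "q i differentiable (at x)"
      using derivs_boundedD(1)[OF q i, of x] unfolding differentiable_def by blast
  qed
  have coeff: "C_bounded n I (\<lambda>i x. frechet_derivative g (at (x, u i x)) c)" if "c \<in> Basis" for c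
    by (rule C_bounded_compose[OF C_bounded_antimono[OF derivs_boundedD(2)[OF g that]]
          derivs_bounded_graph[OF u]]) simp
  have "C_bounded n I (dir_deriv v u)" if v: "v \<in> Basis" for v
  proof (rule C_bounded_dissipative_system[OF beta])
    show "(\<Sum>c\<in>Basis. (w \<bullet> c) *\<^sub>R frechet_derivative g (at (x, u i x)) (0, c)) \<bullet> w \<le> - \<beta> * (norm w)\<^sup>2"
      if "i \<in> I" for i x w
      by (rule dissipative_partials[OF dg[OF that]])
    show "C_bounded n I (\<lambda>i x. frechet_derivative g (at (x, u i x)) (0, c))" if "c \<in> Basis" for c
      using that by (intro coeff) (simp add: Basis_prod_def)
    show "C_bounded n I (\<lambda>i x. dir_deriv v q i x - frechet_derivative g (at (x, u i x)) (v, 0))"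
      using v by (intro C_bounded_diff derivs_boundedD(2)[OF q] coeff) (simp_all add: Basis_prod_def)
    show "(\<Sum>c\<in>Basis. (dir_deriv v u i x \<bullet> c) *\<^sub>R frechet_derivative g (at (x, u i x)) (0, c)) =
        dir_deriv v q i x - frechet_derivative g (at (x, u i x)) (v, 0)" if i: "i \<in> I" for i x
      using d[OF i] by (intro implicit_derivative_eq[OF dg[OF i] _ derivs_boundedD(1)[OF q i] eq[OF i]])
        (simp add: frechet_derivative_works)
  qed
  then show ?thesis using d by (simp add: derivs_bounded_Suc_iff)
qed

lemma derivs_bounded_implicit:
  assumes eq: "\<And>i x. i \<in> I \<Longrightarrow> g (x, u i x) = q i x"
  shows "derivs_bounded n I (\<lambda>_. g) \<Longrightarrow> derivs_bounded n I q \<Longrightarrow> derivs_bounded n I u"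
proof (induction n)
  case (Suc n)
  have "derivs_bounded n I u"
    by (intro Suc.IH derivs_bounded_antimono[OF Suc.prems(1)] derivs_bounded_antimono[OF Suc.prems(2)]) simp_all
  then show ?case by (intro derivs_bounded_implicit_step[OF Suc.prems _ eq])
qed simp

text \<open>At order 0 this is strong monotonicity with factor 1/\<beta>. At higher orders the
  weighted derivative of \<open>u - v\<close> solves a linear dissipative system with the matrix
  taken at \<open>u\<close>; the mismatch of the coefficients at \<open>u\<close> and
  \<open>v\<close> is bounded through the weighted difference at the previous order.\<close>

lemma C_bounded_implicit_diff:
  assumes eqp: "\<And>i x. i \<in> I \<Longrightarrow> g (x, u i x) = p i x"
    and eqq: "\<And>i x. i \<in> I \<Longrightarrow> g (x, v i x) = q i x"
  shows "derivs_bounded (Suc n) I (\<lambda>_. g) \<Longrightarrow> derivs_bounded n I u \<Longrightarrow> derivs_bounded n I v \<Longrightarrow>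
    C_bounded n I (\<lambda>i x. w i *\<^sub>R (p i x - q i x)) \<Longrightarrow> C_bounded n I (\<lambda>i x. w i *\<^sub>R (u i x - v i x))"
proof (induction n)
  case 0
  obtain M where M: "\<And>i x. i \<in> I \<Longrightarrow> norm (w i *\<^sub>R (p i x - q i x)) \<le> M"
    using 0(4) unfolding C_bounded_def unif_bounded_def by blast
  have "norm (w i *\<^sub>R (u i x - v i x)) \<le> M / \<beta>" if i: "i \<in> I" for i x
  proof -
    have "\<beta> * norm (u i x - v i x) \<le> norm (p i x - q i x)"
      using norm_le_of_dissipative[OF beta diss[of x "u i x" "v i x"]] eqp[OF i] eqq[OF i] by simp
    then have "\<bar>w i\<bar> * (\<beta> * norm (u i x - v i x)) \<le> \<bar>w i\<bar> * norm (p i x - q i x)"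
      by (rule mult_left_mono) simp
    also have "\<dots> \<le> M" using M[OF i, of x] by simp
    finally show ?thesis using beta by (simp add: pos_le_divide_eq mult_ac)
  qed
  then have "unif_bounded I (\<lambda>i x. w i *\<^sub>R (u i x - v i x))" by (rule unif_boundedI)
  then show ?case by (simp add: C_bounded_def)
next
  case (Suc n)
  note g = Suc.prems(1) and u = Suc.prems(2) and v = Suc.prems(3)
  have un: "derivs_bounded n I u" and vn: "derivs_bounded n I v" and gn: "derivs_bounded (Suc n) I (\<lambda>_. g)"
    by (rule derivs_bounded_antimono[OF u] derivs_bounded_antimono[OF v] derivs_bounded_antimono[OF g], simp)+
  have IH: "C_bounded n I (\<lambda>i x. w i *\<^sub>R (u i x - v i x))"
    by (intro Suc.IH gn un vn C_bounded_antimono[OF Suc.prems(4)]) simp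
  have dg: "(g has_derivative frechet_derivative g (at z)) (at z)" if "i \<in> I" for i z
    using derivs_boundedD(1)[OF g that, of z] by simp
  then have dg': "g differentiable (at z)" if "i \<in> I" for i z
    using that unfolding differentiable_def by blast
  \<comment> \<open>Only the weighted difference of \<open>p\<close> and \<open>q\<close> is bounded
    by hypothesis. Their individual differentiability comes from writing each as \<open>g\<close>
    along a graph.\<close>
  have dp: "(p i has_derivative (\<lambda>b. frechet_derivative g (at (x, u i x)) (b, dir_deriv b u i x))) (at x)"
    and dq: "(q i has_derivative (\<lambda>b. frechet_derivative g (at (x, v i x)) (b, dir_deriv b v i x))) (at x)"
    if i: "i \<in> I" for i x
    using has_derivative_compose[OF has_derivative_Pair[OF has_derivative_ident derivs_boundedD(1)[OF u i, of x]]
        dg[OF i, of "(x, u i x)"]]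
      has_derivative_compose[OF has_derivative_Pair[OF has_derivative_ident derivs_boundedD(1)[OF v i, of x]]
        dg[OF i, of "(x, v i x)"]] eqp[OF i] eqq[OF i]
    by simp_all
  have L: "bounded_linear (\<lambda>y. (0 :: 'a, y :: 'b))" 
    by (intro bounded_linear_Pair bounded_linear_zero bounded_linear_ident)
  have "C_bounded n I (\<lambda>i x. w i *\<^sub>R ((x, u i x) - (x, v i x)))"
    using C_bounded_linear[OF L IH] by simp
  then have gdiff: "C_bounded n I (\<lambda>i x. w i *\<^sub>R (frechet_derivative g (at (x, u i x)) c - frechet_derivative g (at (x, v i x)) c))"
    if "c \<in> Basis" for c
    using derivs_boundedD(2)[OF g that]
    by (intro C_bounded_compose_diff[of n I "\<lambda>_ z. frechet_derivative g (at z) c"] derivs_bounded_graph un vn)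
      (simp_all add: C_bounded_def)
  have "C_bounded n I (dir_deriv b (\<lambda>i x. w i *\<^sub>R (u i x - v i x)))" if b: "b \<in> Basis" for b
  proof (rule C_bounded_dissipative_system[OF beta])
    show "(\<Sum>c\<in>Basis. (z \<bullet> c) *\<^sub>R frechet_derivative g (at (x, u i x)) (0, c)) \<bullet> z \<le> - \<beta> * (norm z)\<^sup>2"
      if "i \<in> I" for i x z
      by (rule dissipative_partials[OF dg'[OF that]])
    show "C_bounded n I (\<lambda>i x. frechet_derivative g (at (x, u i x)) (0, c))" if "c \<in> Basis" for c
      using that by (intro C_bounded_compose[OF derivs_boundedD(2)[OF gn] derivs_bounded_graph[OF un]])
        (simp add: Basis_prod_def)
    \<comment> \<open>This right-hand side results from subtracting the two linearised equations and
      moving everything except the matrix at \<open>u\<close> applied to the difference to the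
      right.\<close>
    show "C_bounded n I (\<lambda>i x. dir_deriv b (\<lambda>i x. w i *\<^sub>R (p i x - q i x)) i x
        - w i *\<^sub>R (frechet_derivative g (at (x, u i x)) (b, 0) - frechet_derivative g (at (x, v i x)) (b, 0))
        - (\<Sum>c\<in>Basis. (dir_deriv b v i x \<bullet> c) *\<^sub>R
            (w i *\<^sub>R (frechet_derivative g (at (x, u i x)) (0, c) - frechet_derivative g (at (x, v i x)) (0, c)))))"
      using b Suc.prems(4) derivs_boundedD(2)[OF v b]
      by (intro C_bounded_diff C_bounded_sum C_bounded_scaleR C_bounded_linear[OF bounded_linear_inner_left] gdiff)
        (auto simp: Basis_prod_def C_bounded_Suc_iff derivs_boundedD(2))
    fix i x assume i: "i \<in> I"
    have "((\<lambda>x. w i *\<^sub>R (p i x - q i x)) has_derivative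
        (\<lambda>b. w i *\<^sub>R (frechet_derivative g (at (x, u i x)) (b, dir_deriv b u i x)
          - frechet_derivative g (at (x, v i x)) (b, dir_deriv b v i x)))) (at x)"
      by (intro has_derivative_scaleR_right has_derivative_diff dp dq i)
    from fun_cong[OF frechet_derivative_at[OF this], of b]
    have wpq: "dir_deriv b (\<lambda>i x. w i *\<^sub>R (p i x - q i x)) i x =
       w i *\<^sub>R (frechet_derivative g (at (x, u i x)) (b, dir_deriv b u i x)
          - frechet_derivative g (at (x, v i x)) (b, dir_deriv b v i x))"
      by (rule sym)
    have eu: "(\<Sum>c\<in>Basis. (dir_deriv b u i x \<bullet> c) *\<^sub>R frechet_derivative g (at (x, u i x)) (0, c)) =
        frechet_derivative g (at (x, u i x)) (b, dir_deriv b u i x) - frechet_derivative g (at (x, u i x)) (b, 0)"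
      by (rule implicit_derivative_eq[where u' = "\<lambda>b. dir_deriv b u i x",
            OF dg'[OF i] derivs_boundedD(1)[OF u i] dp[OF i] eqp[OF i]])
    have ev: "(\<Sum>c\<in>Basis. (dir_deriv b v i x \<bullet> c) *\<^sub>R frechet_derivative g (at (x, v i x)) (0, c)) =
        frechet_derivative g (at (x, v i x)) (b, dir_deriv b v i x) - frechet_derivative g (at (x, v i x)) (b, 0)"
      by (rule implicit_derivative_eq[where u' = "\<lambda>b. dir_deriv b v i x",
            OF dg'[OF i] derivs_boundedD(1)[OF v i] dq[OF i] eqq[OF i]])
    have "(\<Sum>c\<in>Basis. (dir_deriv b (\<lambda>i x. w i *\<^sub>R (u i x - v i x)) i x \<bullet> c) *\<^sub>R
        frechet_derivative g (at (x, u i x)) (0, c)) =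
        w i *\<^sub>R ((\<Sum>c\<in>Basis. (dir_deriv b u i x \<bullet> c) *\<^sub>R frechet_derivative g (at (x, u i x)) (0, c))
          - (\<Sum>c\<in>Basis. (dir_deriv b v i x \<bullet> c) *\<^sub>R frechet_derivative g (at (x, u i x)) (0, c)))"
      unfolding dir_deriv_scaled_diff[OF u v i]
      by (simp add: inner_diff_left scaleR_diff_left scaleR_diff_right sum_subtractf scaleR_sum_right)
    \<comment> \<open>The derivative of \<open>v\<close> satisfies its own system with the matrix at
      \<open>v\<close>, so the matrix at \<open>u\<close> is replaced by that one plus a
      correction.\<close>
    also have "(\<Sum>c\<in>Basis. (dir_deriv b v i x \<bullet> c) *\<^sub>R frechet_derivative g (at (x, u i x)) (0, c)) =
        (\<Sum>c\<in>Basis. (dir_deriv b v i x \<bullet> c) *\<^sub>R frechet_derivative g (at (x, v i x)) (0, c)) +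
        (\<Sum>c\<in>Basis. (dir_deriv b v i x \<bullet> c) *\<^sub>R
          (frechet_derivative g (at (x, u i x)) (0, c) - frechet_derivative g (at (x, v i x)) (0, c)))"
      by (simp add: scaleR_diff_right sum.distrib sum_subtractf)
    finally show "(\<Sum>c\<in>Basis. (dir_deriv b (\<lambda>i x. w i *\<^sub>R (u i x - v i x)) i x \<bullet> c) *\<^sub>R
        frechet_derivative g (at (x, u i x)) (0, c)) = 
        dir_deriv b (\<lambda>i x. w i *\<^sub>R (p i x - q i x)) i x
        - w i *\<^sub>R (frechet_derivative g (at (x, u i x)) (b, 0) - frechet_derivative g (at (x, v i x)) (b, 0))
        - (\<Sum>c\<in>Basis. (dir_deriv b v i x \<bullet> c) *\<^sub>R
            (w i *\<^sub>R (frechet_derivative g (at (x, u i x)) (0, c) - frechet_derivative g (at (x, v i x)) (0, c))))"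
      unfolding eu ev wpq by (simp add: scaleR_diff_right scaleR_add_right scaleR_sum_right mult.commute)
  qed
  moreover have "(\<lambda>x. w i *\<^sub>R (u i x - v i x)) differentiable (at x)" if "i \<in> I" for i x
    unfolding differentiable_def
    by (rule exI, rule has_derivative_scaleR_right[OF has_derivative_diff[OF
        derivs_boundedD(1)[OF u that] derivs_boundedD(1)[OF v that]]])
  ultimately have "derivs_bounded (Suc n) I (\<lambda>i x. w i *\<^sub>R (u i x - v i x))"
    by (simp add: derivs_bounded_Suc_iff)
  then show ?case using IH by (simp add: C_bounded_def)
qed

end

section \<open>Sobolev norms of smooth functions\<close>

text \<open>The set where the bound fails is open and null, hence empty. This turns essential
  suprema into bounds at every point, which the evaluation along solution curves requires.\<close>

lemma continuous_le_of_AE_le: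
  fixes \<phi> :: "'a::euclidean_space \<Rightarrow> real"
  assumes cont: "continuous_on UNIV \<phi>" and ae: "AE z in lebesgue. \<phi> z \<le> M"
  shows "\<phi> z \<le> M"
proof -
  have op: "open {z. M < \<phi> z}" using cont by (intro open_Collect_less) auto
  have "{z. M < \<phi> z} \<in> null_sets lebesgue"
    using ae AE_iff_null_sets[of "{z. M < \<phi> z}" lebesgue] op by (auto simp: not_less)
  then have "negligible {z. M < \<phi> z}" by (simp add: negligible_iff_null_sets)
  then have "{z. M < \<phi> z} = {}" using op open_not_negligible by blast
  then show ?thesis by (auto simp: not_less)
qed

lemma sobolev_norm_AE_bound:
  fixes \<xi> :: "'a::euclidean_space \<Rightarrow> 'b::real_normed_vector"
  assumes "sobolev_norm k \<xi> < \<infinity>"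
  obtains M where "\<And>vs. set vs \<subseteq> Basis \<Longrightarrow> length vs \<le> k \<Longrightarrow> AE z in lebesgue. norm (partial_deriv vs \<xi> z) \<le> M"
proof -
  obtain M where M: "sobolev_norm k \<xi> \<le> ereal M"
    using assms by (cases "sobolev_norm k \<xi>") auto
  have "AE z in lebesgue. norm (partial_deriv vs \<xi> z) \<le> M" if vs: "set vs \<subseteq> Basis" "length vs \<le> k" for vs
  proof -
    have "esssup lebesgue (\<lambda>z. ereal (nabla_norm (length vs) \<xi> z)) \<le> sobolev_norm k \<xi>"
      unfolding sobolev_norm_def using vs by (intro Max_ge) auto
    also note M
    finally have "AE z in lebesgue. nabla_norm (length vs) \<xi> z \<le> M"
      using eventually_mono[OF esssup_AE[of "\<lambda>z. ereal (nabla_norm (length vs) \<xi> z)" lebesgue]]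
      by (metis (no_types, lifting) ereal_less_eq(3) order_trans)
    moreover have "norm (partial_deriv vs \<xi> z) \<le> nabla_norm (length vs) \<xi> z" for z
      unfolding nabla_norm_def
      using vs finite_lists_length_eq[of Basis "length vs"]
      by (intro member_le_L2_set) (auto simp: multi_indices_def)
    ultimately show ?thesis by (auto elim!: eventually_mono intro: order_trans)
  qed
  then show thesis by (rule that)
qed

text \<open>The parameter \<open>m\<close> is the lowest order carrying a bound: 0 for
  \<open>f\<close>, but 1 for \<open>g\<close>, of which only the gradient is bounded.\<close>

lemma C_bounded_partial_deriv:
  fixes \<xi> :: "'a::euclidean_space \<Rightarrow> 'b::real_normed_vector"
  assumes diff: "\<And>vs z. set vs \<subseteq> Basis \<Longrightarrow> length vs < N \<Longrightarrow> partial_deriv vs \<xi> differentiable (at z)"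
    and bound: "\<And>vs z. set vs \<subseteq> Basis \<Longrightarrow> m \<le> length vs \<Longrightarrow> length vs \<le> N \<Longrightarrow> norm (partial_deriv vs \<xi> z) \<le> M"
  shows "set vs \<subseteq> Basis \<Longrightarrow> m \<le> length vs \<Longrightarrow> length vs + n \<le> N \<Longrightarrow> C_bounded n I (\<lambda>_. partial_deriv vs \<xi>)"
proof (induction n arbitrary: vs)
  case 0
  then show ?case unfolding C_bounded_def by (auto intro!: unif_boundedI bound)
next
  case (Suc n)
  have "C_bounded n I (\<lambda>_. partial_deriv (v # vs) \<xi>)" if "v \<in> Basis" for v
    using Suc.prems that by (intro Suc.IH) auto
  then have "derivs_bounded (Suc n) I (\<lambda>_. partial_deriv vs \<xi>)"
    using Suc.prems diff by (auto simp: derivs_bounded_Suc_iff)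
  moreover have "unif_bounded I (\<lambda>_. partial_deriv vs \<xi>)"
    using Suc.prems by (intro unif_boundedI[of _ _ M] bound) auto
  ultimately show ?case by (simp add: C_bounded_def)
qed

lemma C_k_smoothD:
  assumes "C_k_smooth k \<xi>" "set vs \<subseteq> Basis"
  shows "length vs < k \<Longrightarrow> partial_deriv vs \<xi> differentiable (at z)"
    and "length vs \<le> k \<Longrightarrow> continuous_on UNIV (partial_deriv vs \<xi>)"
  using assms unfolding C_k_smooth_def multi_indices_def by auto

lemma C_bounded_of_sobolev:
  fixes f :: "'a::euclidean_space \<Rightarrow> 'b::real_normed_vector"
  assumes f: "C_k_smooth k f" and s: "sobolev_norm k f < \<infinity>"
  shows "C_bounded k I (\<lambda>_. f)"
proof -
  obtain M where M: "\<And>vs. set vs \<subseteq> Basis \<Longrightarrow> length vs \<le> k \<Longrightarrow> AE z in lebesgue. norm (partial_deriv vs f z) \<le> M"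
    using sobolev_norm_AE_bound[OF s] by metis
  have "norm (partial_deriv vs f z) \<le> M" if "set vs \<subseteq> Basis" "length vs \<le> k" for vs z
    by (rule continuous_le_of_AE_le[OF continuous_on_norm[OF C_k_smoothD(2)[OF f that]] M[OF that]])
  then have "C_bounded k I (\<lambda>_. partial_deriv [] f)"
    using C_k_smoothD(1)[OF f] by (intro C_bounded_partial_deriv[where m = 0 and N = k]) auto
  then show ?thesis by simp
qed

section \<open>Derivatives of the operator-valued gradient\<close>

lemma blinfun_basis_expansion:
  fixes T :: "'a::euclidean_space \<Rightarrow>\<^sub>L 'b::real_normed_vector"
  shows "T = (\<Sum>b\<in>Basis. blinfun_scaleR_left (T b) o\<^sub>L blinfun_inner_left b)"
  by (rule blinfun_eqI) (simp add: blinfun.sum_left blinfun.sum_right[symmetric]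
      blinfun.scaleR_right[symmetric] euclidean_representation)

lemma blinfun_differentiable_componentwise:
  fixes H :: "'c::real_normed_vector \<Rightarrow> 'a::euclidean_space \<Rightarrow>\<^sub>L 'b::real_normed_vector"
  assumes "\<And>b. b \<in> Basis \<Longrightarrow> (\<lambda>z. H z b) differentiable (at x)"
  shows "H differentiable (at x)"
proof -
  have L: "bounded_linear (\<lambda>c. blinfun_scaleR_left c o\<^sub>L blinfun_inner_left b)" for b :: 'a and c :: 'b
    by (intro bounded_linear_intros)
  have "(\<lambda>z. \<Sum>b\<in>Basis. blinfun_scaleR_left (H z b) o\<^sub>L blinfun_inner_left b) differentiable (at x)"
  proof (intro differentiable_sum ballI)
    fix b :: 'a assume "b \<in> Basis"
    then obtain D where "((\<lambda>z. H z b) has_derivative D) (at x)"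
      using assms unfolding differentiable_def by blast
    from bounded_linear.has_derivative[OF L this]
    show "(\<lambda>z. blinfun_scaleR_left (H z b) o\<^sub>L blinfun_inner_left b) differentiable (at x)"
      by (rule differentiableI)
  qed simp
  then show ?thesis by (simp only: blinfun_basis_expansion[symmetric])
qed

text \<open>Evaluation at \<open>b\<close> commutes with differentiation only once the
  operator-valued derivative exists. That is deduced componentwise from the smoothness of
  \<open>g\<close>. The gradient is the derivative taken first, so its direction stands last in the
  list.\<close>

lemma partial_deriv_gradient:
  fixes g :: "'a::euclidean_space \<Rightarrow> 'b::real_normed_vector"
  assumes g: "C_k_smooth (Suc k) g" 
  shows "set vs \<subseteq> Basis \<Longrightarrow> length vs \<le> k \<Longrightarrow> b \<in> Basis \<Longrightarrow>
    blinfun_apply (partial_deriv vs (gradient g) z) b = partial_deriv (vs @ [b]) g z"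
proof (induction vs arbitrary: z b)
  case Nil
  have "g differentiable (at z)" using C_k_smoothD(1)[OF g, of "[]"] by simp
  then have "bounded_linear (frechet_derivative g (at z))"
    by (auto simp: frechet_derivative_works intro: has_derivative_bounded_linear)
  then show ?case by (simp add: gradient_def bounded_linear_Blinfun_apply)
next
  case (Cons v vs)
  have IH: "blinfun_apply (partial_deriv vs (gradient g) z) b = partial_deriv (vs @ [b]) g z"
    if "b \<in> Basis" for b z using Cons.prems that by (intro Cons.IH) auto
  have "partial_deriv (vs @ [b]) g differentiable (at z)" if "b \<in> Basis" for b
    using Cons.prems that by (intro C_k_smoothD(1)[OF g]) auto
  then have "partial_deriv vs (gradient g) differentiable (at z)"
    by (intro blinfun_differentiable_componentwise) (simp add: IH)
  then have "(partial_deriv vs (gradient g) has_derivative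
      frechet_derivative (partial_deriv vs (gradient g)) (at z)) (at z)"
    by (simp add: frechet_derivative_works)
  then have "((\<lambda>z. blinfun_apply (partial_deriv vs (gradient g) z) b) has_derivative
      (\<lambda>v. blinfun_apply (frechet_derivative (partial_deriv vs (gradient g)) (at z) v) b)) (at z)"
    by (rule bounded_linear.has_derivative[OF blinfun.bounded_linear_left])
  then have "(partial_deriv (vs @ [b]) g has_derivative
      (\<lambda>v. blinfun_apply (frechet_derivative (partial_deriv vs (gradient g)) (at z) v) b)) (at z)"
    using IH[OF Cons.prems(3)] by simp
  from fun_cong[OF frechet_derivative_at[OF this], of v] show ?case by simp
qed

lemma derivs_bounded_of_sobolev_gradient:
  fixes g :: "'a::euclidean_space \<Rightarrow> 'b::real_normed_vector"
  assumes g: "C_k_smooth (Suc k) g" and s: "sobolev_norm k (gradient g) < \<infinity>"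
  shows "derivs_bounded (Suc k) I (\<lambda>_. g)"
proof -
  obtain M where M: "\<And>vs. set vs \<subseteq> Basis \<Longrightarrow> length vs \<le> k \<Longrightarrow>
      AE z in lebesgue. norm (partial_deriv vs (gradient g) z) \<le> M"
    using sobolev_norm_AE_bound[OF s] by metis
  have bound: "norm (partial_deriv vs g z) \<le> M"
    if vs: "set vs \<subseteq> Basis" "1 \<le> length vs" "length vs \<le> Suc k" for vs z
  proof -
    obtain ws b where ws: "vs = ws @ [b]" using vs(2) by (cases vs rule: rev_cases) auto
    have ws': "set ws \<subseteq> Basis" "length ws \<le> k" "b \<in> Basis" using vs ws by auto
    have "norm (partial_deriv vs g z) \<le> norm (partial_deriv ws (gradient g) z)" for z
      using norm_blinfun[of "partial_deriv ws (gradient g) z" b] ws'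
      by (simp add: partial_deriv_gradient[OF g ws'] ws)
    then have "AE z in lebesgue. norm (partial_deriv vs g z) \<le> M"
      using M[OF ws'(1,2)] by (auto elim!: eventually_mono intro: order_trans)
    then show ?thesis
      by (rule continuous_le_of_AE_le[OF continuous_on_norm[OF C_k_smoothD(2)[OF g vs(1,3)]]])
  qed
  have "C_bounded k I (\<lambda>_. partial_deriv [v] g)" if "v \<in> Basis" for v
    using that bound C_k_smoothD(1)[OF g] by (intro C_bounded_partial_deriv[where m = 1 and N = "Suc k"]) auto
  moreover have "g differentiable (at z)" for z using C_k_smoothD(1)[OF g, of "[]"] by simp
  ultimately show ?thesis by (simp add: derivs_bounded_Suc_iff)
qed

section \<open>The approximate slow manifolds\<close>

lemma C_bounded_const:
  assumes "\<And>i. i \<in> I \<Longrightarrow> norm (c i) \<le> M"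
  shows "C_bounded n I (\<lambda>i x. c i)"
proof -
  have "derivs_bounded n I (\<lambda>i x. c i)"
    by (cases n) (auto intro!: derivs_bounded_SucI has_derivative_const C_bounded_zero)
  then show ?thesis using assms by (auto simp: C_bounded_def intro: unif_boundedI)
qed

text \<open>The right-hand side of the iteration, without the factor \<epsilon>. It is the only
  operation in the iteration that loses an order of \<open>u\<close>.\<close>

lemma C_bounded_transport:
  fixes u :: "'i \<Rightarrow> 'a::euclidean_space \<Rightarrow> 'b::euclidean_space"
  assumes f: "C_bounded n I (\<lambda>_. f)" and u: "derivs_bounded (Suc n) I u"
  shows "C_bounded n I (\<lambda>i x. dir_deriv (f (x, u i x)) u i x)"
proof -
  have un: "derivs_bounded n I u" by (rule derivs_bounded_antimono[OF u]) simp
  have "C_bounded n I (\<lambda>i x. f (x, u i x))"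
    by (rule C_bounded_compose[OF f derivs_bounded_graph[OF un]])
  then have "C_bounded n I (\<lambda>i x. \<Sum>b\<in>Basis. (f (x, u i x) \<bullet> b) *\<^sub>R dir_deriv b u i x)"
    by (intro C_bounded_sum C_bounded_scaleR C_bounded_linear[OF bounded_linear_inner_left]
        derivs_boundedD(2)[OF u]) auto
  then show ?thesis
    by (rule C_bounded_cong[THEN iffD1, rotated])
      (rule linear_basis_expansion[OF has_derivative_linear[OF derivs_boundedD(1)[OF u]], symmetric])
qed

lemma C_bounded_transport_diff:
  fixes u v :: "'i \<Rightarrow> 'a::euclidean_space \<Rightarrow> 'b::euclidean_space"
  assumes f: "C_bounded (Suc n) I (\<lambda>_. f)"
    and u: "derivs_bounded (Suc n) I u" and v: "derivs_bounded (Suc n) I v"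
    and w: "C_bounded (Suc n) I (\<lambda>i x. w i *\<^sub>R (u i x - v i x))"
  shows "C_bounded n I (\<lambda>i x. w i *\<^sub>R (dir_deriv (f (x, u i x)) u i x - dir_deriv (f (x, v i x)) v i x))"
proof -
  have un: "derivs_bounded n I u" and vn: "derivs_bounded n I v"
    by (rule derivs_bounded_antimono[OF u] derivs_bounded_antimono[OF v], simp)+
  have fn: "C_bounded n I (\<lambda>_. f)" and wn: "C_bounded n I (\<lambda>i x. w i *\<^sub>R (u i x - v i x))"
    by (rule C_bounded_antimono[OF f] C_bounded_antimono[OF w], simp)+
  have L: "bounded_linear (\<lambda>y. (0 :: 'a, y :: 'b))" 
    by (intro bounded_linear_Pair bounded_linear_zero bounded_linear_ident)
  have "C_bounded n I (\<lambda>i x. w i *\<^sub>R ((x, u i x) - (x, v i x)))"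
    using C_bounded_linear[OF L wn] by simp
  then have fd: "C_bounded n I (\<lambda>i x. w i *\<^sub>R (f (x, u i x) - f (x, v i x)))"
    by (rule C_bounded_compose_diff[OF f[unfolded C_bounded_Suc_iff, THEN conjunct2]
          derivs_bounded_graph[OF un] derivs_bounded_graph[OF vn]])
  have dw: "C_bounded n I (\<lambda>i x. w i *\<^sub>R (dir_deriv b u i x - dir_deriv b v i x))" if "b \<in> Basis" for b
    using derivs_boundedD(2)[OF w[unfolded C_bounded_Suc_iff, THEN conjunct2] that]
    by (rule C_bounded_cong[THEN iffD1, rotated]) (rule dir_deriv_scaled_diff[OF u v])
  have "C_bounded n I (\<lambda>i x. \<Sum>b\<in>Basis.
      (f (x, u i x) \<bullet> b) *\<^sub>R (w i *\<^sub>R (dir_deriv b u i x - dir_deriv b v i x))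
      + ((w i *\<^sub>R (f (x, u i x) - f (x, v i x))) \<bullet> b) *\<^sub>R dir_deriv b v i x)"
    by (intro C_bounded_sum C_bounded_add C_bounded_scaleR dw fd
        C_bounded_linear[OF bounded_linear_inner_left] derivs_boundedD(2)[OF v]
        C_bounded_compose[OF fn derivs_bounded_graph[OF un]]) auto
  then show ?thesis
  proof (rule C_bounded_cong[THEN iffD1, rotated])
    fix i x assume i: "i \<in> I"
    show "(\<Sum>b\<in>Basis. (f (x, u i x) \<bullet> b) *\<^sub>R (w i *\<^sub>R (dir_deriv b u i x - dir_deriv b v i x))
        + ((w i *\<^sub>R (f (x, u i x) - f (x, v i x))) \<bullet> b) *\<^sub>R dir_deriv b v i x) =
      w i *\<^sub>R (dir_deriv (f (x, u i x)) u i x - dir_deriv (f (x, v i x)) v i x)"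
      unfolding linear_basis_expansion[OF has_derivative_linear[OF derivs_boundedD(1)[OF u i]],
          of _ "f (x, u i x)"]
        linear_basis_expansion[OF has_derivative_linear[OF derivs_boundedD(1)[OF v i]],
          of _ "f (x, v i x)"]
      by (simp add: inner_diff_left scaleR_diff_left scaleR_diff_right sum_subtractf scaleR_sum_right
          sum.distrib mult.commute)
  qed
qed

context dissipative
begin

text \<open>The induction carries the defect instead of the difference of consecutive manifolds.
  Stability turns the defect at level \<open>k\<close> into that difference, and transporting the
  difference produces the defect at level \<open>k + 1\<close> with one further factor \<epsilon>.
  The recursion is conditional on differentiability, which the first conjunct supplies at each
  level.\<close>

lemma slow_manifold_bounds:
  fixes f :: "'a \<times> 'b \<Rightarrow> 'a" and G :: "nat \<Rightarrow> real \<Rightarrow> 'a \<Rightarrow> 'b"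
  defines "I \<equiv> {0<..1}"
  assumes f: "C_bounded K I (\<lambda>_. f)" and g: "derivs_bounded (Suc K) I (\<lambda>_. g)"
    and G0: "\<And>\<epsilon> x. \<epsilon> \<in> I \<Longrightarrow> g (x, G 0 \<epsilon> x) = 0"
    and GSuc: "\<And>k \<epsilon> x. \<epsilon> \<in> I \<Longrightarrow> G k \<epsilon> differentiable (at x) \<Longrightarrow>
      g (x, G (Suc k) \<epsilon> x) = \<epsilon> *\<^sub>R frechet_derivative (G k \<epsilon>) (at x) (f (x, G k \<epsilon> x))"
  shows "k + n = K \<Longrightarrow> derivs_bounded (Suc n) I (G k) \<and>
    C_bounded n I (\<lambda>\<epsilon> x. (1 / \<epsilon> ^ Suc k) *\<^sub>R
      (\<epsilon> *\<^sub>R dir_deriv (f (x, G k \<epsilon> x)) (G k) \<epsilon> x - g (x, G k \<epsilon> x)))"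
proof (induction k arbitrary: n)
  case 0
  have "derivs_bounded (Suc n) I (\<lambda>_ (_ :: 'a). 0 :: 'b)"
    using C_bounded_zero unfolding C_bounded_def by blast
  then have "derivs_bounded (Suc n) I (G 0)"
    using g 0 by (intro derivs_bounded_implicit[OF G0]) simp_all
  \<comment> \<open>Since \<open>g\<close> vanishes on the graph of \<open>G 0\<close>, the rescaled
    defect is just the transport term.\<close>
  moreover have "C_bounded n I (\<lambda>\<epsilon> x. (1 / \<epsilon> ^ Suc 0) *\<^sub>R
      (\<epsilon> *\<^sub>R dir_deriv (f (x, G 0 \<epsilon> x)) (G 0) \<epsilon> x - g (x, G 0 \<epsilon> x)))"
    using C_bounded_transport[of n I f "G 0"] f 0 calculation
    by (rule_tac C_bounded_cong[THEN iffD1, rotated]) (auto simp: G0 I_def)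
  ultimately show ?case by blast
next
  case (Suc k)
  have IH: "derivs_bounded (Suc (Suc n)) I (G k)"
    "C_bounded (Suc n) I (\<lambda>\<epsilon> x. (1 / \<epsilon> ^ Suc k) *\<^sub>R
      (\<epsilon> *\<^sub>R dir_deriv (f (x, G k \<epsilon> x)) (G k) \<epsilon> x - g (x, G k \<epsilon> x)))"
    using Suc.IH[of "Suc n"] Suc.prems by auto
  have fn: "C_bounded (Suc n) I (\<lambda>_. f)" using Suc.prems by (intro C_bounded_antimono[OF f]) simp
  have gn: "derivs_bounded (Suc (Suc n)) I (\<lambda>_. g)" using Suc.prems by (intro derivs_bounded_antimono[OF g]) simp
  have gn': "derivs_bounded (Suc n) I (\<lambda>_. g)" by (rule derivs_bounded_antimono[OF gn]) simp
  have Gk: "derivs_bounded (Suc n) I (G k)" by (rule derivs_bounded_antimono[OF IH(1)]) simp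
  have GSuc: "g (x, G (Suc k) \<epsilon> x) = \<epsilon> *\<^sub>R dir_deriv (f (x, G k \<epsilon> x)) (G k) \<epsilon> x" if "\<epsilon> \<in> I" for \<epsilon> x
    by (rule GSuc[OF that differentiableI[OF derivs_boundedD(1)[OF IH(1) that]]])
  have "C_bounded (Suc n) I (\<lambda>\<epsilon> x. \<epsilon> *\<^sub>R dir_deriv (f (x, G k \<epsilon> x)) (G k) \<epsilon> x)"
    by (intro C_bounded_scaleR C_bounded_transport fn IH(1) C_bounded_const[of _ _ 1]) (auto simp: I_def)
  then have GS: "derivs_bounded (Suc n) I (G (Suc k))"
    by (intro derivs_bounded_implicit[where u = "G (Suc k)", OF GSuc gn']) (simp_all add: C_bounded_def)
  \<comment> \<open>\<open>G k\<close> is viewed as the exact solution of the equation whose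
    right-hand side is \<open>g (x, G k \<epsilon> x)\<close>; the two right-hand sides then differ
    precisely by the defect.\<close>
  have "C_bounded (Suc n) I (\<lambda>\<epsilon> x. (1 / \<epsilon> ^ Suc k) *\<^sub>R (G (Suc k) \<epsilon> x - G k \<epsilon> x))"
    by (rule C_bounded_implicit_diff[OF GSuc refl gn GS Gk IH(2)])
  then have "C_bounded n I (\<lambda>\<epsilon> x. (1 / \<epsilon> ^ Suc k) *\<^sub>R
      (dir_deriv (f (x, G (Suc k) \<epsilon> x)) (G (Suc k)) \<epsilon> x - dir_deriv (f (x, G k \<epsilon> x)) (G k) \<epsilon> x))"
    by (rule C_bounded_transport_diff[OF fn GS Gk])
  \<comment> \<open>By the recursion the new defect is \<epsilon> times the difference of the
    transport terms, which accounts for the extra power in the weight.\<close>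
  then have "C_bounded n I (\<lambda>\<epsilon> x. (1 / \<epsilon> ^ Suc (Suc k)) *\<^sub>R
      (\<epsilon> *\<^sub>R dir_deriv (f (x, G (Suc k) \<epsilon> x)) (G (Suc k)) \<epsilon> x - g (x, G (Suc k) \<epsilon> x)))"
    by (rule C_bounded_cong[THEN iffD1, rotated]) (simp add: GSuc I_def flip: scaleR_diff_right)
  with GS show ?case by blast
qed

end

section \<open>The energy estimate\<close>

lemma has_real_derivative_norm_sq:
  fixes z :: "real \<Rightarrow> 'a::real_inner"
  assumes "(z has_vector_derivative z') (at t within S)"
  shows "((\<lambda>t. (norm (z t))\<^sup>2) has_real_derivative 2 * (z t \<bullet> z')) (at t within S)"
proof -
  have "((\<lambda>t. z t \<bullet> z t) has_derivative (\<lambda>h. z t \<bullet> (h *\<^sub>R z') + (h *\<^sub>R z') \<bullet> z t)) (at t within S)"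
    using assms unfolding has_vector_derivative_def by (intro has_derivative_inner)
  then show ?thesis
    unfolding has_field_derivative_def power2_norm_eq_inner
    by (rule has_derivative_eq_rhs) (auto simp: inner_commute)
qed

lemma gronwall_linear:
  fixes V :: "real \<Rightarrow> real"
  assumes V: "\<And>t. t \<ge> 0 \<Longrightarrow> (V has_real_derivative V' t) (at t within {0..})"
    and le: "\<And>t. t \<ge> 0 \<Longrightarrow> V' t \<le> C * V t" and t: "t \<ge> 0"
  shows "V t \<le> exp (C * t) * V 0"
proof (cases "t = 0")
  case False
  define h where "h s = exp (- C * s) * V s" for s
  have h: "(h has_real_derivative exp (- C * s) * (V' s - C * V s)) (at s within {0..})" if "s \<ge> 0" for s
    unfolding h_def using V[OF that] by (auto intro!: derivative_eq_intros simp: algebra_simps)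
  have "h t \<le> h 0"
  \<comment> \<open>At 0 only a one-sided derivative is available, so the sign is used in the open
    interval and continuity covers the endpoints.\<close>
  proof (rule DERIV_nonpos_imp_decreasing_open[of 0 t h])
    show "0 \<le> t" by (rule t)
    have "continuous_on {0..} h" by (rule DERIV_continuous_on[OF h]) simp
    then show "continuous_on {0..t} h" by (rule continuous_on_subset) auto
    fix s assume s: "0 < s" "s < t"
    have "at s within {0..} = at s" using s by (intro at_within_interior) (simp add: interior_real_atLeast)
    then have "(h has_real_derivative exp (- C * s) * (V' s - C * V s)) (at s)"
      using h[of s] s by simp
    moreover have "exp (- C * s) * (V' s - C * V s) \<le> 0"
      using le[of s] s by (intro mult_nonneg_nonpos) simp_all
    ultimately show "\<exists>y. (h has_real_derivative y) (at s) \<and> y \<le> 0" by blast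
  qed
  then show ?thesis
    by (simp add: h_def exp_minus field_simps)
qed simp

context dissipative
begin

text \<open>The lower bound on \<open>C\<close> collects what multiplies the three parts of
  \<open>V\<close>: \<open>L\<^sup>2 + 2 * L * (1 + F)\<close> from the slow error, 2FL from the
  variation of \<Gamma> along \<open>f\<close>, already contained in the former, and
  \<open>(E / \<beta>)\<^sup>2\<close> from the defect. The constant summand of \<open>V\<close>
  keeps the differential inequality homogeneous despite the defect.\<close>

lemma slow_fast_reduced_estimate:
  fixes f :: "'a \<times> 'b \<Rightarrow> 'a" and \<Gamma> :: "'a \<Rightarrow> 'b"
  assumes eps: "\<epsilon> > 0" and L: "L \<ge> 0" and F: "F \<ge> 0"
    and f: "\<And>z z'. norm (f z - f z') \<le> L * norm (z - z')"
    and \<Gamma>': "\<And>x. (\<Gamma> has_derivative \<Gamma>' x) (at x)"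
    and \<Gamma>'_le: "\<And>x v. norm (\<Gamma>' x v) \<le> F * norm v"
    and \<Gamma>_le: "\<And>x x'. norm (\<Gamma> x - \<Gamma> x') \<le> F * norm (x - x')"
    and res: "\<And>x. norm (\<epsilon> *\<^sub>R \<Gamma>' x (f (x, \<Gamma> x)) - g (x, \<Gamma> x)) \<le> E * \<epsilon> ^ Suc k"
    and sol: "slow_fast_solution f g \<epsilon> x0 y0 x y" and red: "reduced_solution f \<Gamma> X"
    and C: "C \<ge> 1 + L\<^sup>2 + 2 * L * (1 + F) + (E / \<beta>)\<^sup>2" and t: "t \<ge> 0"
  shows "(norm (x t - X t))\<^sup>2 \<le> exp (C * t) *
    ((norm (x 0 - X 0))\<^sup>2 + \<epsilon> ^ (2 * k + 2) + C * \<epsilon> / \<beta> * (norm (y 0 - \<Gamma> (x 0)))\<^sup>2)"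
proof -
  define z where "z t = y t - \<Gamma> (x t)" for t
  define z' where "z' t = (1 / \<epsilon>) *\<^sub>R g (x t, y t) - \<Gamma>' (x t) (f (x t, y t))" for t
  define d where "d t = x t - X t" for t
  define d' where "d' t = f (x t, y t) - f (X t, \<Gamma> (X t))" for t
  define V where "V t = (norm (d t))\<^sup>2 + \<epsilon> / \<beta> * (norm (z t))\<^sup>2 + \<epsilon> ^ (2 * k + 2)" for t
  have x: "(x has_vector_derivative f (x t, y t)) (at t within {0..})"
    and y: "(y has_vector_derivative (1 / \<epsilon>) *\<^sub>R g (x t, y t)) (at t within {0..})"
    and X: "(X has_vector_derivative f (X t, \<Gamma> (X t))) (at t within {0..})" if "t \<ge> 0" for t
    using sol red that by (auto simp: slow_fast_solution_def reduced_solution_def)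
  have dd: "(d has_vector_derivative d' t) (at t within {0..})" if "t \<ge> 0" for t
    unfolding d_def d'_def by (intro has_vector_derivative_diff x X that)
  have dz: "(z has_vector_derivative z' t) (at t within {0..})" if "t \<ge> 0" for t
  proof -
    have "((\<lambda>t. \<Gamma> (x t)) has_derivative (\<lambda>h. \<Gamma>' (x t) (h *\<^sub>R f (x t, y t)))) (at t within {0..})"
      using x[OF that] \<Gamma>' unfolding has_vector_derivative_def by (rule has_derivative_compose)
    then have "((\<lambda>t. \<Gamma> (x t)) has_vector_derivative \<Gamma>' (x t) (f (x t, y t))) (at t within {0..})"
      unfolding has_vector_derivative_def by (simp add: linear_scale[OF has_derivative_linear[OF \<Gamma>']])
    then show ?thesis unfolding z_def z'_def by (intro has_vector_derivative_diff y that)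
  qed
  have d_le: "2 * (d t \<bullet> d' t) \<le> (L\<^sup>2 + 2 * L * (1 + F)) * (norm (d t))\<^sup>2 + (norm (z t))\<^sup>2" for t
  proof -
    have "d' t = (f (x t, y t) - f (x t, \<Gamma> (x t))) + (f (x t, \<Gamma> (x t)) - f (X t, \<Gamma> (X t)))"
      by (simp add: d'_def)
    then have "norm (d' t) \<le> L * norm (z t) + L * (norm (d t) + F * norm (d t))"
    proof (rule ssubst, intro order_trans[OF norm_triangle_ineq] add_mono)
      show "norm (f (x t, y t) - f (x t, \<Gamma> (x t))) \<le> L * norm (z t)"
        using f[of "(x t, y t)" "(x t, \<Gamma> (x t))"] by (simp add: z_def norm_Pair)
      have "norm ((x t, \<Gamma> (x t)) - (X t, \<Gamma> (X t))) \<le> norm (d t) + F * norm (d t)"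
        using norm_Pair_le[of "x t - X t" "\<Gamma> (x t) - \<Gamma> (X t)"] \<Gamma>_le[of "x t" "X t"] by (simp add: d_def)
      then show "norm (f (x t, \<Gamma> (x t)) - f (X t, \<Gamma> (X t))) \<le> L * (norm (d t) + F * norm (d t))"
        using f L by (meson mult_left_mono order_trans)
    qed
    then have "norm (d t) * norm (d' t) \<le> norm (d t) * (L * norm (z t) + L * (norm (d t) + F * norm (d t)))"
      by (rule mult_left_mono) simp
    then have "2 * (d t \<bullet> d' t) \<le> 2 * (norm (d t) * (L * norm (z t) + L * (norm (d t) + F * norm (d t))))"
      using norm_cauchy_schwarz[of "d t" "d' t"] by linarith
    \<comment> \<open>Adding a square is Young's inequality, normalised so that |z|^2 has
      coefficient exactly 1.\<close>
    also have "\<dots> \<le> 2 * (norm (d t) * (L * norm (z t) + L * (norm (d t) + F * norm (d t))))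
        + (L * norm (d t) - norm (z t))\<^sup>2" by simp
    also have "\<dots> = (L\<^sup>2 + 2 * L * (1 + F)) * (norm (d t))\<^sup>2 + (norm (z t))\<^sup>2"
      by (simp add: power2_eq_square algebra_simps)
    finally show ?thesis .
  qed
  have z_le: "\<epsilon> / \<beta> * (2 * (z t \<bullet> z' t)) \<le> - (norm (z t))\<^sup>2 + (E / \<beta>)\<^sup>2 * \<epsilon> ^ (2 * k + 2)
      + 2 * F * L * (\<epsilon> / \<beta> * (norm (z t))\<^sup>2)" for t
  proof -
    define r where "r = \<epsilon> *\<^sub>R \<Gamma>' (x t) (f (x t, \<Gamma> (x t))) - g (x t, \<Gamma> (x t))"
    define s where "s = \<Gamma>' (x t) (f (x t, \<Gamma> (x t)) - f (x t, y t))"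
    \<comment> \<open>Adding and subtracting values at \<open>y = \<Gamma> x\<close> separates a
      monotone increment of \<open>g\<close>, the defect \<open>r\<close>, and the error
      \<open>s\<close> from evaluating \<open>f\<close> off the manifold.\<close>
    have "\<epsilon> *\<^sub>R z' t = (g (x t, y t) - g (x t, \<Gamma> (x t))) - r + \<epsilon> *\<^sub>R s"
      using eps by (simp add: z'_def r_def s_def linear_diff[OF has_derivative_linear[OF \<Gamma>']] algebra_simps)
    then have "\<epsilon> * (z t \<bullet> z' t) = (g (x t, y t) - g (x t, \<Gamma> (x t))) \<bullet> z t - z t \<bullet> r + \<epsilon> * (z t \<bullet> s)"
      by (metis (no_types, lifting) inner_add_right inner_diff_right inner_scaleR_right inner_commute)
    moreover have "(g (x t, y t) - g (x t, \<Gamma> (x t))) \<bullet> z t \<le> - \<beta> * (norm (z t))\<^sup>2"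
      using diss by (simp add: z_def)
    moreover have "- (z t \<bullet> r) \<le> norm (z t) * (E * \<epsilon> ^ Suc k)"
      using Cauchy_Schwarz_ineq2[of "z t" r] mult_left_mono[OF res[of "x t"], of "norm (z t)"]
      by (simp add: r_def)
    moreover have "\<epsilon> * (z t \<bullet> s) \<le> \<epsilon> * (norm (z t) * (F * (L * norm (z t))))"
    proof (intro mult_left_mono)
      have "norm s \<le> F * norm (f (x t, \<Gamma> (x t)) - f (x t, y t))" unfolding s_def by (rule \<Gamma>'_le)
      also have "\<dots> \<le> F * (L * norm (z t))"
        using f[of "(x t, \<Gamma> (x t))" "(x t, y t)"] F
        by (intro mult_left_mono) (simp_all add: z_def norm_Pair norm_minus_commute)
      finally show "z t \<bullet> s \<le> norm (z t) * (F * (L * norm (z t)))"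
        using norm_cauchy_schwarz[of "z t" s] by (meson mult_left_mono norm_ge_zero order_trans)
    qed (use eps in simp)
    ultimately have *: "\<epsilon> * (z t \<bullet> z' t) \<le> - \<beta> * (norm (z t))\<^sup>2 + norm (z t) * (E * \<epsilon> ^ Suc k)
        + \<epsilon> * (norm (z t) * (F * (L * norm (z t))))" by linarith
    have "\<epsilon> / \<beta> * (2 * (z t \<bullet> z' t)) = 2 / \<beta> * (\<epsilon> * (z t \<bullet> z' t))" by simp
    also have "\<dots> \<le> 2 / \<beta> * (- \<beta> * (norm (z t))\<^sup>2 + norm (z t) * (E * \<epsilon> ^ Suc k)
        + \<epsilon> * (norm (z t) * (F * (L * norm (z t)))))"
      using beta by (intro mult_left_mono *) simp
    also have "\<dots> = - 2 * (norm (z t))\<^sup>2 + 2 * norm (z t) * (E / \<beta> * \<epsilon> ^ Suc k)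
        + 2 * F * L * (\<epsilon> / \<beta> * (norm (z t))\<^sup>2)"
      using beta by (simp add: distrib_left diff_divide_distrib power2_eq_square mult_ac)
    also have "\<dots> \<le> - (norm (z t))\<^sup>2 + (E / \<beta>)\<^sup>2 * (\<epsilon> ^ Suc k)\<^sup>2 + 2 * F * L * (\<epsilon> / \<beta> * (norm (z t))\<^sup>2)"
      using sum_squares_bound[of "norm (z t)" "E / \<beta> * \<epsilon> ^ Suc k"] unfolding power_mult_distrib by linarith
    also have "(\<epsilon> ^ Suc k)\<^sup>2 = \<epsilon> ^ (2 * k + 2)"
      unfolding power_mult[symmetric] by (rule arg_cong[where f = "power \<epsilon>"]) simp
    finally show ?thesis .
  qed
  have "V t \<le> exp (C * t) * V 0"
  proof (rule gronwall_linear[OF _ _ t])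
    show "(V has_real_derivative 2 * (d t \<bullet> d' t) + \<epsilon> / \<beta> * (2 * (z t \<bullet> z' t))) (at t within {0..})"
      if "t \<ge> 0" for t
      unfolding V_def
      using DERIV_add[OF DERIV_add[OF has_real_derivative_norm_sq[OF dd[OF that]]
            DERIV_cmult[OF has_real_derivative_norm_sq[OF dz[OF that]], of "\<epsilon> / \<beta>"]] DERIV_const]
      by (simp only: add_0_right)
    fix t :: real
    define c where "c = L\<^sup>2 + 2 * L * (1 + F)"
    have "(E / \<beta>)\<^sup>2 \<ge> 0" "L\<^sup>2 \<ge> 0" "L * F \<ge> 0" using L F by simp_all
    then have C': "c \<le> C" "(E / \<beta>)\<^sup>2 \<le> C" "2 * F * L \<le> C"
      using C L unfolding c_def by (simp_all only: distrib_left mult.assoc mult.commute[of F])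
    \<comment> \<open>The terms +|z|^2 from \<open>d_le\<close> and -|z|^2 from \<open>z_le\<close>
      cancel.\<close>
    have "2 * (d t \<bullet> d' t) + \<epsilon> / \<beta> * (2 * (z t \<bullet> z' t)) \<le>
        c * (norm (d t))\<^sup>2 + 2 * F * L * (\<epsilon> / \<beta> * (norm (z t))\<^sup>2) + (E / \<beta>)\<^sup>2 * \<epsilon> ^ (2 * k + 2)"
      using d_le[of t] z_le[of t] unfolding c_def by linarith
    also have "\<dots> \<le> C * (norm (d t))\<^sup>2 + C * (\<epsilon> / \<beta> * (norm (z t))\<^sup>2) + C * \<epsilon> ^ (2 * k + 2)"
      using eps beta by (intro add_mono mult_right_mono C') simp_all
    finally show "2 * (d t \<bullet> d' t) + \<epsilon> / \<beta> * (2 * (z t \<bullet> z' t)) \<le> C * V t"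
      by (simp add: V_def algebra_simps)
  qed
  moreover have "(norm (x t - X t))\<^sup>2 \<le> V t"
    using eps beta by (simp add: V_def d_def)
  \<comment> \<open>The summand 1 in the lower bound on \<open>C\<close> gives
    \<open>C \<ge> 1\<close>, so the initial weight \<epsilon>/\<beta> is dominated by the stated
    C\<epsilon>/\<beta>.\<close>
  moreover have "V 0 \<le> (norm (x 0 - X 0))\<^sup>2 + \<epsilon> ^ (2 * k + 2) + C * \<epsilon> / \<beta> * (norm (y 0 - \<Gamma> (x 0)))\<^sup>2"
  proof -
    have "L\<^sup>2 + 2 * L * (1 + F) + (E / \<beta>)\<^sup>2 \<ge> 0" using L F by simp
    then have "1 * (\<epsilon> / \<beta> * (norm (z 0))\<^sup>2) \<le> C * (\<epsilon> / \<beta> * (norm (z 0))\<^sup>2)"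
      using C eps beta by (intro mult_right_mono) (linarith, simp)
    then show ?thesis by (simp add: V_def d_def z_def)
  qed
  then have "exp (C * t) * V 0 \<le> exp (C * t) *
    ((norm (x 0 - X 0))\<^sup>2 + \<epsilon> ^ (2 * k + 2) + C * \<epsilon> / \<beta> * (norm (y 0 - \<Gamma> (x 0)))\<^sup>2)"
    by (intro mult_left_mono) simp_all
  ultimately show ?thesis by linarith
qed

end

section \<open>Uniform constants and the asymptotic consequence\<close>

theorem theorem3p10:
  fixes f :: "(real^'n) \<times> (real^'m) \<Rightarrow> real^'n"
    and g :: "(real^'n) \<times> (real^'m) \<Rightarrow> real^'m"
    and \<gamma> :: "real^'n \<Rightarrow> real^'m"
    and \<Gamma> :: "nat \<Rightarrow> real^'n \<Rightarrow> real \<Rightarrow> real^'m"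
    and \<beta> :: real
    and K :: nat
  assumes K: "K \<ge> 1"
    and f_smooth: "C_k_smooth K f"
    and g_smooth: "C_k_smooth (K + 1) g"
    and f_bounded: "sobolev_norm K f < \<infinity>"
    and g_bounded: "sobolev_norm K (gradient g) < \<infinity>"
    and gamma: "\<And>x. g (x, \<gamma> x) = 0"
    and beta: "\<beta> > 0"
    and dissipative:
      "\<And>x y y'. (g (x, y) - g (x, y')) \<bullet> (y - y') \<le> - \<beta> * (norm (y - y'))\<^sup>2"
    and Gamma_0: "\<And>x \<epsilon>. \<epsilon> > 0 \<Longrightarrow> \<Gamma> 0 x \<epsilon> = \<gamma> x"
    and Gamma_Suc: "\<And>k x \<epsilon>. \<epsilon> > 0 \<Longrightarrow>
      g (x, \<Gamma> (Suc k) x \<epsilon>) =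
        \<epsilon> *\<^sub>R (jacobian (\<lambda>\<xi>. \<Gamma> k \<xi> \<epsilon>) (at x) *v f (x, \<Gamma> k x \<epsilon>))"
  shows "\<exists>\<epsilon>0>0. \<epsilon>0 < 1 \<and> (\<forall>k\<le>K.
      (\<exists>C>0. \<forall>\<epsilon>\<in>{0<..\<epsilon>0}. \<forall>x0 y0 x y X.
         slow_fast_solution f g \<epsilon> x0 y0 x y \<longrightarrow>
         reduced_solution f (\<lambda>\<xi>. \<Gamma> k \<xi> \<epsilon>) X \<longrightarrow>
         (\<forall>t\<ge>0. (norm (x t - X t))\<^sup>2 \<le>
            exp (C * t) *
              ((norm (x 0 - X 0))\<^sup>2 + \<epsilon> ^ (2 * k + 2) +
               C * \<epsilon> / \<beta> * (norm (y 0 - \<Gamma> k (x 0) \<epsilon>))\<^sup>2)))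
      \<and>
      (\<forall>x0 y0 x y X.
         (\<forall>\<epsilon>\<in>{0<..\<epsilon>0}.
            slow_fast_solution f g \<epsilon> (x0 \<epsilon>) (y0 \<epsilon>) (x \<epsilon>) (y \<epsilon>) \<and>
            reduced_solution f (\<lambda>\<xi>. \<Gamma> k \<xi> \<epsilon>) (X \<epsilon>)) \<longrightarrow>
         (\<lambda>\<epsilon>. norm (x \<epsilon> 0 - X \<epsilon> 0)) \<in> O[at_right 0](\<lambda>\<epsilon>. \<epsilon> ^ (k + 1)) \<longrightarrow>
         (\<lambda>\<epsilon>. norm (y \<epsilon> 0 - \<Gamma> k (x \<epsilon> 0) \<epsilon>)) \<in> O[at_right 0](\<lambda>\<epsilon>. \<epsilon> powr (real k + 1 / 2)) \<longrightarrow>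
         (\<forall>T>0. \<exists>M. \<forall>\<^sub>F \<epsilon> in at_right 0. \<forall>t\<in>{0..T}.
            norm (x \<epsilon> t - X \<epsilon> t) \<le> M * \<epsilon> ^ (k + 1))))"
proof -
  define I where "I = {0<..(1::real)}"
  \<comment> \<open>The arguments are swapped so that \<epsilon> indexes a family of functions of
    \<open>x\<close>; bounds for the family are then uniform in \<epsilon>.\<close>
  define G where "G k \<epsilon> = (\<lambda>x. \<Gamma> k x \<epsilon>)" for k \<epsilon>
  interpret dissipative g \<beta>
    using beta dissipative by unfold_locales
  have f_C: "C_bounded K I (\<lambda>_. f)"
    by (rule C_bounded_of_sobolev[OF f_smooth f_bounded])
  have g_C: "derivs_bounded (Suc K) I (\<lambda>_. g)"
    using g_smooth g_bounded by (intro derivs_bounded_of_sobolev_gradient) simp_all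
  \<comment> \<open>Here \<open>K \<ge> 1\<close> enters: one bounded derivative makes
    \<open>f\<close> globally Lipschitz.\<close>
  have "derivs_bounded (Suc 0) I (\<lambda>_. f)"
    using f_C K unfolding C_bounded_def by (auto elim: derivs_bounded_antimono)
  then obtain L where L: "L > 0" "\<And>z z'. norm (f z - f z') \<le> L * norm (z - z')"
    using derivs_bounded_imp_Lipschitz[of I "\<lambda>_. f"] by (metis I_def greaterThanAtMost_iff order_refl zero_less_one)
  have main: "\<exists>C>0. \<forall>\<epsilon>\<in>{0<..1/2}. \<forall>x0 y0 x y X.
         slow_fast_solution f g \<epsilon> x0 y0 x y \<longrightarrow>
         reduced_solution f (\<lambda>\<xi>. \<Gamma> k \<xi> \<epsilon>) X \<longrightarrow>
         (\<forall>t\<ge>0. (norm (x t - X t))\<^sup>2 \<le>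
            exp (C * t) *
              ((norm (x 0 - X 0))\<^sup>2 + \<epsilon> ^ (2 * k + 2) +
               C * \<epsilon> / \<beta> * (norm (y 0 - \<Gamma> k (x 0) \<epsilon>))\<^sup>2))"
    if k: "k \<le> K" for k
  proof -
    have "derivs_bounded (Suc (K - k)) I (G k) \<and>
      C_bounded (K - k) I (\<lambda>\<epsilon> x. (1 / \<epsilon> ^ Suc k) *\<^sub>R
        (\<epsilon> *\<^sub>R dir_deriv (f (x, G k \<epsilon> x)) (G k) \<epsilon> x - g (x, G k \<epsilon> x)))"
      unfolding I_def
    proof (rule slow_manifold_bounds[where K = K])
      fix k \<epsilon> x assume \<epsilon>: "\<epsilon> \<in> {0<..(1::real)}" and d: "G k \<epsilon> differentiable (at x)"
      \<comment> \<open>Differentiability lets the Jacobian matrix in the recursion be read as the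
        Frechet derivative.\<close>
      have "jacobian (G k \<epsilon>) (at x) *v v = frechet_derivative (G k \<epsilon>) (at x) v" for v
        using fun_cong[OF frechet_derivative_at[OF jacobian_works[THEN iffD1, OF d]]] .
      then show "g (x, G (Suc k) \<epsilon> x) = \<epsilon> *\<^sub>R frechet_derivative (G k \<epsilon>) (at x) (f (x, G k \<epsilon> x))"
        using Gamma_Suc[of \<epsilon> x k] \<epsilon> by (simp add: G_def)
    qed (use f_C g_C gamma Gamma_0 k in \<open>auto simp: I_def G_def\<close>)
    then have D: "derivs_bounded (Suc (K - k)) I (G k)"
      and R: "C_bounded (K - k) I (\<lambda>\<epsilon> x. (1 / \<epsilon> ^ Suc k) *\<^sub>R
        (\<epsilon> *\<^sub>R dir_deriv (f (x, G k \<epsilon> x)) (G k) \<epsilon> x - g (x, G k \<epsilon> x)))"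
      by blast+
    have "derivs_bounded (Suc 0) I (G k)" by (rule derivs_bounded_antimono[OF D]) simp
    then obtain F where F: "F > 0" "\<And>\<epsilon> x y. \<epsilon> \<in> I \<Longrightarrow> norm (G k \<epsilon> x - G k \<epsilon> y) \<le> F * norm (x - y)"
      "\<And>\<epsilon> x v. \<epsilon> \<in> I \<Longrightarrow> norm (dir_deriv v (G k) \<epsilon> x) \<le> F * norm v"
      using derivs_bounded_imp_Lipschitz[of I "G k"] by metis
    obtain E where E: "\<And>\<epsilon> x. \<epsilon> \<in> I \<Longrightarrow> norm ((1 / \<epsilon> ^ Suc k) *\<^sub>R
        (\<epsilon> *\<^sub>R dir_deriv (f (x, G k \<epsilon> x)) (G k) \<epsilon> x - g (x, G k \<epsilon> x))) \<le> E"
      using R unfolding C_bounded_def unif_bounded_def by blast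
    have res: "norm (\<epsilon> *\<^sub>R dir_deriv (f (x, G k \<epsilon> x)) (G k) \<epsilon> x - g (x, G k \<epsilon> x)) \<le> E * \<epsilon> ^ Suc k"
      if "\<epsilon> \<in> I" for \<epsilon> x
      using E[OF that, of x] that by (simp add: I_def pos_divide_le_eq)
    \<comment> \<open>\<open>L\<close>, \<open>F\<close> and \<open>E\<close> were all fixed for the
      whole family, before any \<epsilon> or solution is chosen.\<close>
    define C where "C = 1 + L\<^sup>2 + 2 * L * (1 + F) + (E / \<beta>)\<^sup>2"
    have "C > 0" using L F by (simp add: C_def add_pos_nonneg)
    moreover have "(norm (x t - X t))\<^sup>2 \<le> exp (C * t) *
        ((norm (x 0 - X 0))\<^sup>2 + \<epsilon> ^ (2 * k + 2) + C * \<epsilon> / \<beta> * (norm (y 0 - \<Gamma> k (x 0) \<epsilon>))\<^sup>2)"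
      if \<epsilon>: "\<epsilon> \<in> {0<..1/2}" and sol: "slow_fast_solution f g \<epsilon> x0 y0 x y"
        and red: "reduced_solution f (\<lambda>\<xi>. \<Gamma> k \<xi> \<epsilon>) X" and t: "t \<ge> 0" for \<epsilon> x0 y0 x y X t
    proof -
      have \<epsilon>I: "\<epsilon> \<in> I" "\<epsilon> > 0" using \<epsilon> by (auto simp: I_def)
      show ?thesis
        using slow_fast_reduced_estimate[where \<Gamma> = "G k \<epsilon>", OF \<epsilon>I(2) _ _ L(2)
            derivs_boundedD(1)[OF D \<epsilon>I(1)] F(3)[OF \<epsilon>I(1)] F(2)[OF \<epsilon>I(1)] res[OF \<epsilon>I(1)] sol _
            eq_refl[OF C_def[symmetric]] t] L(1) F(1) red
        by (simp add: G_def)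
    qed
    ultimately show ?thesis by blast
  qed
  have asymp: "\<exists>M. \<forall>\<^sub>F \<epsilon> in at_right 0. \<forall>t\<in>{0..T}. norm (x \<epsilon> t - X \<epsilon> t) \<le> M * \<epsilon> ^ (k + 1)"
    if k: "k \<le> K"
      and sol: "\<forall>\<epsilon>\<in>{0<..1/2}. slow_fast_solution f g \<epsilon> (x0 \<epsilon>) (y0 \<epsilon>) (x \<epsilon>) (y \<epsilon>) \<and>
            reduced_solution f (\<lambda>\<xi>. \<Gamma> k \<xi> \<epsilon>) (X \<epsilon>)"
      and Ox: "(\<lambda>\<epsilon>. norm (x \<epsilon> 0 - X \<epsilon> 0)) \<in> O[at_right 0](\<lambda>\<epsilon>. \<epsilon> ^ (k + 1))"
      and Oz: "(\<lambda>\<epsilon>. norm (y \<epsilon> 0 - \<Gamma> k (x \<epsilon> 0) \<epsilon>)) \<in> O[at_right 0](\<lambda>\<epsilon>. \<epsilon> powr (real k + 1 / 2))"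
      and T: "T > 0"
    for k T x0 y0 x y X
  proof -
    obtain C where C: "C > 0" "\<And>\<epsilon> t. \<epsilon> \<in> {0<..1/2} \<Longrightarrow> t \<ge> 0 \<Longrightarrow>
        (norm (x \<epsilon> t - X \<epsilon> t))\<^sup>2 \<le> exp (C * t) * ((norm (x \<epsilon> 0 - X \<epsilon> 0))\<^sup>2 + \<epsilon> ^ (2 * k + 2) +
               C * \<epsilon> / \<beta> * (norm (y \<epsilon> 0 - \<Gamma> k (x \<epsilon> 0) \<epsilon>))\<^sup>2)"
      using main[OF k] sol by blast
    obtain a where a: "a > 0" "\<forall>\<^sub>F \<epsilon> in at_right 0. norm (x \<epsilon> 0 - X \<epsilon> 0) \<le> a * \<bar>\<epsilon> ^ (k + 1)\<bar>"
      using Ox by (auto elim!: landau_o.bigE)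
    obtain b where b: "b > 0" "\<forall>\<^sub>F \<epsilon> in at_right 0. norm (y \<epsilon> 0 - \<Gamma> k (x \<epsilon> 0) \<epsilon>) \<le> b * \<bar>\<epsilon> powr (real k + 1 / 2)\<bar>"
      using Oz by (auto elim!: landau_o.bigE)
    \<comment> \<open>The summands bound the three initial contributions relative to
      \<open>\<epsilon> ^ (2 * k + 2)\<close>. For the last one the squared hypothesis gives
      \<open>\<epsilon> ^ (2 * k + 1)\<close>, and the prefactor \<epsilon> of the estimate supplies
      the missing power.\<close>
    define P where "P = exp (C * T) * (a\<^sup>2 + 1 + C / \<beta> * b\<^sup>2)"
    have P: "P \<ge> 0" using C(1) beta by (simp add: P_def)
    have "\<forall>\<^sub>F \<epsilon> in at_right 0. \<epsilon> \<in> {0<..1/2::real}"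
      by (rule eventually_at_rightI[of 0 "1/2"]) auto
    with a(2) b(2) have "\<forall>\<^sub>F \<epsilon> in at_right 0. \<forall>t\<in>{0..T}. norm (x \<epsilon> t - X \<epsilon> t) \<le> sqrt P * \<epsilon> ^ (k + 1)"
    proof eventually_elim
      case (elim \<epsilon>)
      then have \<epsilon>: "\<epsilon> > 0" by simp
      have sq: "(\<epsilon> ^ (k + 1))\<^sup>2 = \<epsilon> ^ (2 * k + 2)"
        unfolding power_mult[symmetric] by (rule arg_cong[where f = "power \<epsilon>"]) simp
      show ?case
      proof
        fix t assume t: "t \<in> {0..T}"
        have "(norm (x \<epsilon> 0 - X \<epsilon> 0))\<^sup>2 \<le> (a * \<epsilon> ^ (k + 1))\<^sup>2"
          using elim(1) \<epsilon> by (intro power_mono) auto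
        also have "\<dots> = a\<^sup>2 * \<epsilon> ^ (2 * k + 2)" unfolding power_mult_distrib sq ..
        finally have 1: "(norm (x \<epsilon> 0 - X \<epsilon> 0))\<^sup>2 \<le> a\<^sup>2 * \<epsilon> ^ (2 * k + 2)" .
        have "(norm (y \<epsilon> 0 - \<Gamma> k (x \<epsilon> 0) \<epsilon>))\<^sup>2 \<le> (b * \<epsilon> powr (real k + 1 / 2))\<^sup>2"
          using elim(2) \<epsilon> by (intro power_mono) auto
        also have "\<dots> = b\<^sup>2 * \<epsilon> powr real (2 * k + 1)"
          by (simp add: power_mult_distrib power2_eq_square add.commute flip: powr_add)
        also have "\<dots> = b\<^sup>2 * \<epsilon> ^ (2 * k + 1)" using \<epsilon> by (simp only: powr_realpow)
        finally have "\<epsilon> * (norm (y \<epsilon> 0 - \<Gamma> k (x \<epsilon> 0) \<epsilon>))\<^sup>2 \<le> \<epsilon> * (b\<^sup>2 * \<epsilon> ^ (2 * k + 1))"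
          using \<epsilon> by (intro mult_left_mono) auto
        then have "C / \<beta> * (\<epsilon> * (norm (y \<epsilon> 0 - \<Gamma> k (x \<epsilon> 0) \<epsilon>))\<^sup>2) \<le> C / \<beta> * (\<epsilon> * (b\<^sup>2 * \<epsilon> ^ (2 * k + 1)))"
          by (rule mult_left_mono) (use C(1) beta in simp)
        then have 2: "C * \<epsilon> / \<beta> * (norm (y \<epsilon> 0 - \<Gamma> k (x \<epsilon> 0) \<epsilon>))\<^sup>2 \<le> C / \<beta> * b\<^sup>2 * \<epsilon> ^ (2 * k + 2)"
          by (simp add: mult_ac)
        have "(norm (x \<epsilon> t - X \<epsilon> t))\<^sup>2 \<le> exp (C * t) * ((norm (x \<epsilon> 0 - X \<epsilon> 0))\<^sup>2 + \<epsilon> ^ (2 * k + 2) +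
               C * \<epsilon> / \<beta> * (norm (y \<epsilon> 0 - \<Gamma> k (x \<epsilon> 0) \<epsilon>))\<^sup>2)"
          using C(2) elim(3) t by auto
        also have "\<dots> \<le> exp (C * T) * (a\<^sup>2 * \<epsilon> ^ (2 * k + 2) + \<epsilon> ^ (2 * k + 2) + C / \<beta> * b\<^sup>2 * \<epsilon> ^ (2 * k + 2))"
        proof (rule mult_mono)
          show "exp (C * t) \<le> exp (C * T)" using t C(1) by simp
          show "(norm (x \<epsilon> 0 - X \<epsilon> 0))\<^sup>2 + \<epsilon> ^ (2 * k + 2) +
               C * \<epsilon> / \<beta> * (norm (y \<epsilon> 0 - \<Gamma> k (x \<epsilon> 0) \<epsilon>))\<^sup>2 \<le>
            a\<^sup>2 * \<epsilon> ^ (2 * k + 2) + \<epsilon> ^ (2 * k + 2) + C / \<beta> * b\<^sup>2 * \<epsilon> ^ (2 * k + 2)"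
            using 1 2 by linarith
        qed (use C(1) \<epsilon> beta in simp_all)
        also have "\<dots> = P * (\<epsilon> ^ (k + 1))\<^sup>2"
          unfolding sq P_def by (simp add: algebra_simps)
        also have "\<dots> = (sqrt P * \<epsilon> ^ (k + 1))\<^sup>2" using P by (simp add: power_mult_distrib)
        finally show "norm (x \<epsilon> t - X \<epsilon> t) \<le> sqrt P * \<epsilon> ^ (k + 1)"
          by (rule power2_le_imp_le) (use P \<epsilon> in simp)
      qed
    qed
    then show ?thesis by blast
  qed
  show ?thesis
  \<comment> \<open>The estimates hold up to \<epsilon> = 1; the value 1/2 meets the requirement
    that the threshold be strictly below 1.\<close>
  proof (rule exI[of _ "1/2"], intro conjI allI impI)
    fix k assume k: "k \<le> K"
    show "\<exists>C>0. \<forall>\<epsilon>\<in>{0<..1/2}. \<forall>x0 y0 x y X.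
         slow_fast_solution f g \<epsilon> x0 y0 x y \<longrightarrow>
         reduced_solution f (\<lambda>\<xi>. \<Gamma> k \<xi> \<epsilon>) X \<longrightarrow>
         (\<forall>t\<ge>0. (norm (x t - X t))\<^sup>2 \<le>
            exp (C * t) *
              ((norm (x 0 - X 0))\<^sup>2 + \<epsilon> ^ (2 * k + 2) +
               C * \<epsilon> / \<beta> * (norm (y 0 - \<Gamma> k (x 0) \<epsilon>))\<^sup>2))"
      by (rule main[OF k])
  qed (simp, simp, rule asymp)
qed

end
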